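(* Let $\mathfrak R$ be the Sierpiński gasket or the pentagonal Sierpiński carpet iterated graph system, with replacement graphs $G_m$ and with the flipping symmetries $\eta_t$ ($t\in\mathcal T$) described in the context. Let $p\in(1,\infty)$ and $q=\frac{p}{p-1}$. Then there is a constant $C_{\mathrm{FB}}>0$, independent of $m\in\mathbb N$ and of $t\in\mathcal T$, such that for every $m\in\mathbb N$ there exists a flow basis $\mathcal F^{(m)}$ of $\widetilde G_m$ with \[ \mathcal E_q(\mathcal F^{(m)})\le C_{\mathrm{FB}}\cdot\mathcal E_q\!\left(I_{t,-}^{(m)},I_{t,+}^{(m)},G_m\right)\quad\text{for all }t\in\mathcal T. \]
   Context: Graphs: $(V,E)$, $V$ finite non-empty, $E\subseteq V\times V$, $(x,y)\in E\Rightarrow(y,x)\notin E$; $\{x,y\}\in E$ means either orientation. Flows: an antisymmetric $F:V\times V\to\mathbb R$ ($F(x,y)=-F(y,x)$, $F(x,y)=0$ unless $\{x,y\}\in E$) is a flow from $A$ to $B$ (disjoint non-empty) if $\operatorname{div}F(x):=\sum_{\{x,y\}\in E}F(x,y)=0$ for $x\notin A\cup B$; unit if $\sum_{x\in A}\operatorname{div}F(x)=1$; $\mathcal E_q(F)=\sum_{\{x,y\}\in E}|F(x,y)|^q$ (each edge once); $\mathcal E_q(A,B,G)=\inf\{\mathcal E_q(F):F$ unit flow from $A$ to $B$ in $G\}$. An iterated graph system: connected graph $G_1=(S,E)$, types $\mathcal T$, surjective typing $\mathfrak t$, gluing rules $I_t\subseteq S\times S$; $I_{t,+}$, $I_{t,-}$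 are the sets of first, resp. second, coordinates of $I_t$ and $I^{(m)}_{t,\star}=(I_{t,\star})^m$. With $W_m=S^m$, $[w]_k=w_1\cdots w_k$, replacement graphs $G_m=(W_m,E_m)$: $(w,v)\in E_{m+1}$ iff (1) $[w]_m=[v]_m$ and $(w_{m+1},v_{m+1})\in E$ (type $\mathfrak t(w_{m+1},v_{m+1})$) or (2) $([w]_m,[v]_m)\in E_m$ and $(w_{m+1},v_{m+1})\in I_{\mathfrak t([w]_m,[v]_m)}$ (type $\mathfrak t([w]_m,[v]_m)$). Sierpiński gasket: $S=\{0,1,2\}$, $E=\{(0,1),(1,2),(0,2)\}$ of types $a,b,c$, $I_a=\{(1,0)\}$, $I_b=\{(2,1)\}$, $I_c=\{(2,0)\}$; flipping symmetries: $\eta_a$ fixes $2$ and swaps $0,1$; $\eta_b$ fixes $0$ and swaps $1,2$; $\eta_c$ fixes $1$ and swaps $0,2$. Pentagonal Sierpiński carpet: $S=\{0,\dots,4\}$ (arithmetic mod 5), $E=\{(0,1),(1,2),(2,3),(3,4),(4,0)\}$ of types $a,b,c,d,e$, $I_a=\{(1,0),(2,4)\}$, $I_b=\{(2,1),(3,0)\}$, $I_c=\{(3,2),(4,1)\}$, $I_d=\{(4,3),(0,2)\}$, $I_e=\{(0,4),(1,3)\}$; for $k\in S$ let $\eta^{(k)}$ be the involution of $S$ fixing $k$ with $\eta^{(k)}(k+1)=k-1$ and $\eta^{(k)}(k+2)=k+3$; the flipping symmetry of the type of the edge $(i,i+1)$ is $\eta^{(i+3)}$. Flipping symmetries act on $W_m$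 letterwise. Flow basis: $\mathcal L^{(m)}=\{I^{(m)}_{t,\star}:t\in\mathcal T,\star\in\{+,-\}\}$ (a set; equal sets identified). $\widetilde G_m$ has vertex set $W_m\cup\{v_L:L\in\mathcal L^{(m)},v\in L\}$ (new formal symbols) and edges $E_m\cup\{\{v_L,v\}:L\in\mathcal L^{(m)},v\in L\}$; $\widetilde L=\{v_L:v\in L\}$. A flow basis is a collection $\mathcal F^{(m)}$ of flows in $\widetilde G_m$ with: (FB1) each member is a unit flow from $\widetilde L_1$ to $\widetilde L_2$ for distinct $L_1,L_2\in\mathcal L^{(m)}$, with exactly one member, $\mathcal F_{[L_1\to L_2]}$, for each ordered pair of distinct $L_1,L_2$; (FB2) if $L\notin\{L_1,L_2\}$ then $\mathcal F_{[L_1\to L_2]}(v_L,v)=0$ for $v\in L$; (FB3) if $L\notin\{L_1,L_2\}$ then for $v\in L$, $\mathcal F_{[L\to L_1]}(v_L,v)=\mathcal F_{[L\to L_2]}(v_L,v)$ and $\mathcal F_{[L_1\to L]}(v,v_L)=\mathcal F_{[L_2\to L]}(v,v_L)$; (FB4) if $L_1=I^{(m)}_{t,\star}$, $L_2=I^{(m)}_{t,-\star}$ then for $v\in L_1$, $\mathcal F_{[L_1\to L_2]}(v_{L_1},v)=\mathcal F_{[L_1\to L_2]}(\eta_t(v),\eta_t(v)_{L_2})$ and $\mathcal F_{[L_1\to L_2]}(v_{L_1},v)=\mathcal F_{[L_2\to L_1]}(v,v_{L_1})$. $\mathcal E_q(\mathcal F^{(m)})=\max_{F\in\mathcal F^{(m)}}\mathcal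 E_q(F)$. *)

theory Defs
  imports "HOL-Analysis.Analysis"
begin

text \<open>A graph is given by a vertex set V and a set E of oriented edges, E a subset of V x V,
  with (x,y) in E implying (y,x) not in E. An unoriented edge {x,y} is present iff
  (x,y) in E or (y,x) in E.\<close>

definition uedge :: "('v \<times> 'v) set \<Rightarrow> 'v \<Rightarrow> 'v \<Rightarrow> bool" where
  "uedge E x y \<longleftrightarrow> (x, y) \<in> E \<or> (y, x) \<in> E"

definition is_antisym_fun :: "('v \<times> 'v) set \<Rightarrow> ('v \<Rightarrow> 'v \<Rightarrow> real) \<Rightarrow> bool" where
  "is_antisym_fun E F \<longleftrightarrow> (\<forall>x y. F x y = - F y x) \<and> (\<forall>x y. \<not> uedge E x y \<longrightarrow> F x y = 0)"

definition flow_div :: "('v \<times> 'v) set \<Rightarrow> ('v \<Rightarrow> 'v \<Rightarrow> real) \<Rightarrow> 'v \<Rightarrow> real" where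
  "flow_div E F x = (\<Sum>y\<in>{y. uedge E x y}. F x y)"

definition is_flow :: "'v set \<Rightarrow> ('v \<times> 'v) set \<Rightarrow> 'v set \<Rightarrow> 'v set \<Rightarrow> ('v \<Rightarrow> 'v \<Rightarrow> real) \<Rightarrow> bool" where
  "is_flow V E A B F \<longleftrightarrow>
     A \<subseteq> V \<and> B \<subseteq> V \<and> A \<noteq> {} \<and> B \<noteq> {} \<and> A \<inter> B = {} \<and>
     is_antisym_fun E F \<and> (\<forall>x\<in>V. x \<notin> A \<union> B \<longrightarrow> flow_div E F x = 0)"

definition is_unit_flow :: "'v set \<Rightarrow> ('v \<times> 'v) set \<Rightarrow> 'v set \<Rightarrow> 'v set \<Rightarrow> ('v \<Rightarrow> 'v \<Rightarrow> real) \<Rightarrow> bool" where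
  "is_unit_flow V E A B F \<longleftrightarrow> is_flow V E A B F \<and> (\<Sum>x\<in>A. flow_div E F x) = 1"

text \<open>q-energy, each (unoriented) edge counted once.\<close>
definition flow_energy :: "real \<Rightarrow> ('v \<times> 'v) set \<Rightarrow> ('v \<Rightarrow> 'v \<Rightarrow> real) \<Rightarrow> real" where
  "flow_energy q E F = (\<Sum>(x, y)\<in>E. \<bar>F x y\<bar> powr q)"

definition eff_energy :: "real \<Rightarrow> 'v set \<Rightarrow> ('v \<times> 'v) set \<Rightarrow> 'v set \<Rightarrow> 'v set \<Rightarrow> real" where
  "eff_energy q V E A B = Inf (flow_energy q E ` {F. is_unit_flow V E A B F})"

text \<open>Data of an iterated graph system together with its flipping symmetries:
  letters S, edges E of G_1, types T, typing, gluing rules I_t, flips eta_t.\<close>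
record ('a, 't) igs =
  igsS :: "'a set"
  igsE :: "('a \<times> 'a) set"
  igsT :: "'t set"
  igsTyp :: "'a \<times> 'a \<Rightarrow> 't"
  igsI :: "'t \<Rightarrow> ('a \<times> 'a) set"
  igsEta :: "'t \<Rightarrow> 'a \<Rightarrow> 'a"

definition words :: "('a, 't) igs \<Rightarrow> nat \<Rightarrow> 'a list set" where
  "words R m = {w. length w = m \<and> set w \<subseteq> igsS R}"

text \<open>Typed edges of the replacement graph G_m (pairs of an oriented edge and its type),
  following rules (1) and (2). G_1 = (S,E) (up to identifying a letter with a word of length one).\<close>
primrec typed_edges :: "('a, 't) igs \<Rightarrow> nat \<Rightarrow> (('a list \<times> 'a list) \<times> 't) set" where
  "typed_edges R 0 = {}"
| "typed_edges R (Suc m) =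
     {((w @ [a], w @ [b]), igsTyp R (a, b)) | w a b. w \<in> words R m \<and> (a, b) \<in> igsE R}
   \<union> {((w @ [a], v @ [b]), t) | w v a b t. ((w, v), t) \<in> typed_edges R m \<and> (a, b) \<in> igsI R t}"

definition edges :: "('a, 't) igs \<Rightarrow> nat \<Rightarrow> ('a list \<times> 'a list) set" where
  "edges R m = fst ` typed_edges R m"

text \<open>I_{t,+} (first coordinates), I_{t,-} (second coordinates), and their m-th powers.
  The boolean flag: True = +, False = -.\<close>
definition Ipm :: "('a, 't) igs \<Rightarrow> 't \<Rightarrow> bool \<Rightarrow> 'a set" where
  "Ipm R t s = (if s then fst ` igsI R t else snd ` igsI R t)"

definition Ipow :: "('a, 't) igs \<Rightarrow> nat \<Rightarrow> 't \<Rightarrow> bool \<Rightarrow> 'a list set" where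
  "Ipow R m t s = {w. length w = m \<and> set w \<subseteq> Ipm R t s}"

definition Lsets :: "('a, 't) igs \<Rightarrow> nat \<Rightarrow> 'a list set set" where
  "Lsets R m = {Ipow R m t s | t s. t \<in> igsT R}"

text \<open>The augmented graph tilde G_m: old vertices Inl w, new formal vertices v_L = Inr (L, v).\<close>
type_synonym 'a tvert = "'a list + ('a list set \<times> 'a list)"

definition tverts :: "('a, 't) igs \<Rightarrow> nat \<Rightarrow> 'a tvert set" where
  "tverts R m = Inl ` words R m \<union> {Inr (L, v) | L v. L \<in> Lsets R m \<and> v \<in> L}"

definition tedges :: "('a, 't) igs \<Rightarrow> nat \<Rightarrow> ('a tvert \<times> 'a tvert) set" where
  "tedges R m = {(Inl w, Inl v) | w v. (w, v) \<in> edges R m}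
              \<union> {(Inr (L, v), Inl v) | L v. L \<in> Lsets R m \<and> v \<in> L}"

definition tilde :: "'a list set \<Rightarrow> 'a tvert set" where
  "tilde L = {Inr (L, v) | v. v \<in> L}"

definition flipw :: "('a, 't) igs \<Rightarrow> 't \<Rightarrow> 'a list \<Rightarrow> 'a list" where
  "flipw R t w = map (igsEta R t) w"

definition is_flow_basis :: "('a, 't) igs \<Rightarrow> nat
    \<Rightarrow> ('a list set \<Rightarrow> 'a list set \<Rightarrow> 'a tvert \<Rightarrow> 'a tvert \<Rightarrow> real) \<Rightarrow> bool" where
  "is_flow_basis R m FB \<longleftrightarrow>
     \<comment> \<open>FB1\<close>
     (\<forall>L1\<in>Lsets R m. \<forall>L2\<in>Lsets R m. L1 \<noteq> L2 \<longrightarrow>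
        is_unit_flow (tverts R m) (tedges R m) (tilde L1) (tilde L2) (FB L1 L2)) \<and>
     \<comment> \<open>FB2\<close>
     (\<forall>L1\<in>Lsets R m. \<forall>L2\<in>Lsets R m. \<forall>L\<in>Lsets R m. L1 \<noteq> L2 \<longrightarrow> L \<notin> {L1, L2} \<longrightarrow>
        (\<forall>v\<in>L. FB L1 L2 (Inr (L, v)) (Inl v) = 0)) \<and>
     \<comment> \<open>FB3\<close>
     (\<forall>L1\<in>Lsets R m. \<forall>L2\<in>Lsets R m. \<forall>L\<in>Lsets R m. L1 \<noteq> L2 \<longrightarrow> L \<notin> {L1, L2} \<longrightarrow>
        (\<forall>v\<in>L. FB L L1 (Inr (L, v)) (Inl v) = FB L L2 (Inr (L, v)) (Inl v)
              \<and> FB L1 L (Inl v) (Inr (L, v)) = FB L2 L (Inl v) (Inr (L, v)))) \<and>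
     \<comment> \<open>FB4\<close>
     (\<forall>t\<in>igsT R. \<forall>s. Ipow R m t s \<noteq> Ipow R m t (\<not> s) \<longrightarrow>
        (let L1 = Ipow R m t s; L2 = Ipow R m t (\<not> s) in
         \<forall>v\<in>L1. FB L1 L2 (Inr (L1, v)) (Inl v)
                  = FB L1 L2 (Inl (flipw R t v)) (Inr (L2, flipw R t v))
               \<and> FB L1 L2 (Inr (L1, v)) (Inl v) = FB L2 L1 (Inl v) (Inr (L1, v))))"

definition fb_energy :: "real \<Rightarrow> ('a, 't) igs \<Rightarrow> nat
    \<Rightarrow> ('a list set \<Rightarrow> 'a list set \<Rightarrow> 'a tvert \<Rightarrow> 'a tvert \<Rightarrow> real) \<Rightarrow> real" where
  "fb_energy q R m FB = Max {flow_energy q (tedges R m) (FB L1 L2) | L1 L2.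
        L1 \<in> Lsets R m \<and> L2 \<in> Lsets R m \<and> L1 \<noteq> L2}"

text \<open>Sierpinski gasket: letters 0,1,2; types a,b,c encoded as 0,1,2.\<close>
definition sierpinski_gasket :: "(nat, nat) igs" where
  "sierpinski_gasket = \<lparr>
     igsS = {0, 1, 2},
     igsE = {(0, 1), (1, 2), (0, 2)},
     igsT = {0, 1, 2},
     igsTyp = (\<lambda>e. if e = (0, 1) then 0 else if e = (1, 2) then 1 else 2),
     igsI = (\<lambda>t. if t = 0 then {(1, 0)} else if t = 1 then {(2, 1)} else {(2, 0)}),
     igsEta = (\<lambda>t x.
        if t = 0 then (if x = 0 then 1 else if x = 1 then 0 else x)
        else if t = 1 then (if x = 1 then 2 else if x = 2 then 1 else x)
        else (if x = 0 then 2 else if x = 2 then 0 else x)) \<rparr>"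

text \<open>eta^(k): the reflection x |-> 2k - x (mod 5) of Z/5; it fixes k, swaps k+1 with k-1
  and k+2 with k+3 (arguments taken in {0..4}).\<close>
definition pent_eta :: "nat \<Rightarrow> nat \<Rightarrow> nat" where
  "pent_eta k x = (2 * k + 5 - x) mod 5"

text \<open>Pentagonal Sierpinski carpet: letters 0..4; types a..e encoded as 0..4, the edge
  (i, i+1) having type i.\<close>
definition pentagonal_carpet :: "(nat, nat) igs" where
  "pentagonal_carpet = \<lparr>
     igsS = {0..<5},
     igsE = {(i, (i + 1) mod 5) | i. i < 5},
     igsT = {0..<5},
     igsTyp = fst,
     igsI = (\<lambda>t. {((t + 1) mod 5, t), ((t + 2) mod 5, (t + 4) mod 5)}),
     igsEta = (\<lambda>t. pent_eta ((t + 3) mod 5)) \<rparr>"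

end

theory Submission
  imports Defs "HOL-Combinatorics.Permutations"
begin

text \<open>
  Write \<open>\<alpha> ~ \<beta>\<close> if some flow of energy at most a constant times the minimal energy has
  divergence \<open>\<alpha> - \<beta>\<close>. Let \<open>\<alpha>\<close> and \<open>\<beta>\<close> be the source and sink distributions of a nearly
  optimal unit flow between opposite gates \<open>I_{t,-}\<close>, \<open>I_{t,+}\<close>. A flow basis needs one
  distribution on each gate that is compatible with all flipping symmetries, so the point is
  that \<open>\<alpha> ~ g \<alpha>\<close> for every \<open>g\<close> in the group generated by the flips; averaging \<open>g \<alpha>\<close>
  over the \<open>g\<close> carrying \<open>I_{t,-}\<close> to a given gate \<open>L\<close> then gives the distribution on \<open>L\<close>.

  For the gasket gates are single vertices and this is immediate. For the pentagonal carpet take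
  the gates with letters \<open>{0,1}\<close> and \<open>{2,3}\<close>. Folding the graph along the axis through
  the letter 1 reflects the first gate and fixes the second one, and edges crossing the axis join
  mirror images, so they collapse; folding the flow gives \<open>\<tau>_1 \<alpha> ~ \<beta>\<close>, hence
  \<open>\<alpha> ~ \<tau>_1 \<alpha>\<close>. Folding along the axis through 2 gives \<open>\<alpha> ~ \<tau>_2 \<beta> ~ \<tau>_2 \<alpha>\<close>,
  and \<open>\<tau>_1, \<tau>_2\<close> generate the dihedral group.

  Bounded degree controls the energy on the added edges by the energy of the flow.
\<close>

section \<open>Transporting distributions by flows\<close>

text \<open>(FB3) and the second half of (FB4) make the boundary values of the flows depend on the
  gate alone, so a flow basis amounts to one mass \<open>\<nu> L\<close> of total 1 per gate; the
  first half of (FB4) demands that every flip \<open>\<eta>_t\<close> carries the mass of one gate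
  of type t to that of the opposite gate. In the carpet the five gates are the pairs of neighbouring
  letters, and the five types link them into a single cycle. Going once around composes five
  reflections, hence gives a reflection that returns to the gate with its two letters exchanged. So
  \<open>\<nu> L\<close> must be invariant under this exchange. A nearly optimal flow need not have
  this invariance, and it cannot be averaged into having it, because the exchange moves the opposite
  gate. Averaging only the distribution is possible once moving it to its mirror images is cheap,
  which is what folding provides. Masses may be signed, since only totals and energies enter.
  Constants are uniform in m because the group is finite and each operation on flows costs a factor
  that does not involve m.\<close>

lemma abs_mean_powr_le:
  fixes f :: "'i \<Rightarrow> real"
  assumes "finite I" "I \<noteq> {}" "0 < q"
  shows "\<bar>(\<Sum>i\<in>I. f i) / card I\<bar> powr q \<le> (\<Sum>i\<in>I. \<bar>f i\<bar> powr q)"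
proof -
  have "Max ((\<lambda>i. \<bar>f i\<bar>) ` I) \<in> (\<lambda>i. \<bar>f i\<bar>) ` I"
    using assms by (intro Max_in) auto
  then obtain j where j: "j \<in> I" "Max ((\<lambda>i. \<bar>f i\<bar>) ` I) = \<bar>f j\<bar>" by auto
  have le: "\<bar>f i\<bar> \<le> \<bar>f j\<bar>" if "i \<in> I" for i
    using that assms j(2)[symmetric] by simp
  have "\<bar>\<Sum>i\<in>I. f i\<bar> \<le> (\<Sum>i\<in>I. \<bar>f i\<bar>)" by (rule sum_abs)
  also have "\<dots> \<le> card I * \<bar>f j\<bar>" using le by (intro sum_bounded_above) auto
  finally have "\<bar>(\<Sum>i\<in>I. f i) / card I\<bar> \<le> \<bar>f j\<bar>"
    using assms by (simp add: divide_le_eq card_gt_0_iff mult.commute)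
  then have "\<bar>(\<Sum>i\<in>I. f i) / card I\<bar> powr q \<le> \<bar>f j\<bar> powr q"
    using assms by (intro powr_mono2) auto
  also have "\<dots> \<le> (\<Sum>i\<in>I. \<bar>f i\<bar> powr q)"
    using assms j by (intro member_le_sum) auto
  finally show ?thesis .
qed

text \<open>The sum is \<open>card I\<close> times the mean, and a mean is at most the largest term.
  The resulting \<open>n powr q\<close> is cruder than what convexity would give, but only its
  independence of the terms matters.\<close>

lemma abs_sum_powr_le:
  fixes f :: "'i \<Rightarrow> real"
  assumes "finite I" "card I \<le> n" "0 < q"
  shows "\<bar>\<Sum>i\<in>I. f i\<bar> powr q \<le> real n powr q * (\<Sum>i\<in>I. \<bar>f i\<bar> powr q)"
proof (cases "I = {}")
  case False
  have "\<bar>\<Sum>i\<in>I. f i\<bar> powr q = real (card I) powr q * \<bar>(\<Sum>i\<in>I. f i) / card I\<bar> powr q"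
    using False assms by (simp add: powr_mult[symmetric])
  also have "\<dots> \<le> real n powr q * (\<Sum>i\<in>I. \<bar>f i\<bar> powr q)"
    using assms False
    by (intro mult_mono abs_mean_powr_le powr_mono2) (auto intro!: sum_nonneg)
  finally show ?thesis .
qed auto

lemma abs_add_powr_le:
  fixes a b :: real
  assumes "0 < q"
  shows "\<bar>a + b\<bar> powr q \<le> 2 powr q * (\<bar>a\<bar> powr q + \<bar>b\<bar> powr q)"
  using abs_sum_powr_le[of "{True, False}" 2 q "\<lambda>i. if i then a else b"] assms by simp

text \<open>The double sum counts every edge in both directions, so the relation ignores the
  orientation of edges; this is the origin of the factor 2 in comparisons with
  \<open>flow_energy\<close>. Only the difference \<open>\<alpha> - \<beta>\<close> enters, and both
  functions may be signed.\<close>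

definition transports ::
    "real \<Rightarrow> 'v set \<Rightarrow> ('v \<Rightarrow> 'v \<Rightarrow> bool) \<Rightarrow> real \<Rightarrow> ('v \<Rightarrow> real) \<Rightarrow> ('v \<Rightarrow> real) \<Rightarrow> bool" where
  "transports q V adj c \<alpha> \<beta> \<longleftrightarrow> (\<exists>F. (\<forall>x y. F x y = - F y x) \<and> (\<forall>x y. F x y \<noteq> 0 \<longrightarrow> adj x y) \<and>
     (\<forall>x\<in>V. (\<Sum>y\<in>V. F x y) = \<alpha> x - \<beta> x) \<and> (\<Sum>x\<in>V. \<Sum>y\<in>V. \<bar>F x y\<bar> powr q) \<le> c)"

definition push :: "'v set \<Rightarrow> ('v \<Rightarrow> 'v) \<Rightarrow> ('v \<Rightarrow> real) \<Rightarrow> 'v \<Rightarrow> real" where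
  "push V \<phi> \<alpha> x = (\<Sum>x'\<in>{x'\<in>V. \<phi> x' = x}. \<alpha> x')"

lemma transportsE:
  assumes "transports q V adj c \<alpha> \<beta>"
  obtains F where "\<And>x y. F x y = - F y x" "\<And>x y. F x y \<noteq> 0 \<Longrightarrow> adj x y"
    "\<And>x. x \<in> V \<Longrightarrow> (\<Sum>y\<in>V. F x y) = \<alpha> x - \<beta> x" "(\<Sum>x\<in>V. \<Sum>y\<in>V. \<bar>F x y\<bar> powr q) \<le> c"
proof -
  from assms[unfolded transports_def] obtain F where F: "\<forall>x y. F x y = - F y x"
    "\<forall>x y. F x y \<noteq> 0 \<longrightarrow> adj x y" "\<forall>x\<in>V. (\<Sum>y\<in>V. F x y) = \<alpha> x - \<beta> x"
    "(\<Sum>x\<in>V. \<Sum>y\<in>V. \<bar>F x y\<bar> powr q) \<le> c"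
    by (elim exE conjE) (rule that)
  show thesis
    by (rule that[of F]; (rule F(1)[rule_format] F(4) | use F(2,3) in blast))
qed

lemma transportsI:
  assumes "\<And>x y. F x y = - F y x" "\<And>x y. F x y \<noteq> 0 \<Longrightarrow> adj x y"
    "\<And>x. x \<in> V \<Longrightarrow> (\<Sum>y\<in>V. F x y) = \<alpha> x - \<beta> x" "(\<Sum>x\<in>V. \<Sum>y\<in>V. \<bar>F x y\<bar> powr q) \<le> c"
  shows "transports q V adj c \<alpha> \<beta>"
  unfolding transports_def using assms by (intro exI[of _ F] conjI allI ballI impI)

lemma transports_mono: "transports q V adj c \<alpha> \<beta> \<Longrightarrow> c \<le> d \<Longrightarrow> transports q V adj d \<alpha> \<beta>"
  by (erule transportsE, rule transportsI) (assumption | erule (1) order_trans)+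

lemma transports_cong:
  assumes "\<And>x. x \<in> V \<Longrightarrow> \<alpha> x = \<alpha>' x" "\<And>x. x \<in> V \<Longrightarrow> \<beta> x = \<beta>' x"
  shows "transports q V adj c \<alpha> \<beta> \<longleftrightarrow> transports q V adj c \<alpha>' \<beta>'"
  using assms unfolding transports_def by simp

lemma transports_refl: "transports q V adj 0 \<alpha> \<alpha>"
  by (rule transportsI[of "\<lambda>_ _. 0"]) auto

lemma transports_sym:
  assumes "transports q V adj c \<alpha> \<beta>" shows "transports q V adj c \<beta> \<alpha>"
proof -
  from assms obtain F where F: "\<And>x y. F x y = - F y x" "\<And>x y. F x y \<noteq> 0 \<Longrightarrow> adj x y"
    "\<And>x. x \<in> V \<Longrightarrow> (\<Sum>y\<in>V. F x y) = \<alpha> x - \<beta> x" "(\<Sum>x\<in>V. \<Sum>y\<in>V. \<bar>F x y\<bar> powr q) \<le> c"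
    by (rule transportsE) blast
  show ?thesis
  proof (rule transportsI[of "\<lambda>x y. - F x y"])
    show "- F x y = - (- F y x)" for x y using F(1)[of x y] by simp
  qed (use F(2-4) in \<open>auto simp: sum_negf\<close>)
qed

lemma transports_trans:
  assumes "transports q V adj c \<alpha> \<beta>" "transports q V adj d \<beta> \<gamma>" "0 < q"
  shows "transports q V adj (2 powr q * (c + d)) \<alpha> \<gamma>"
proof -
  from assms(1) obtain F where F: "\<And>x y. F x y = - F y x" "\<And>x y. F x y \<noteq> 0 \<Longrightarrow> adj x y"
    "\<And>x. x \<in> V \<Longrightarrow> (\<Sum>y\<in>V. F x y) = \<alpha> x - \<beta> x" "(\<Sum>x\<in>V. \<Sum>y\<in>V. \<bar>F x y\<bar> powr q) \<le> c"
    by (rule transportsE) blast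
  from assms(2) obtain G where G: "\<And>x y. G x y = - G y x" "\<And>x y. G x y \<noteq> 0 \<Longrightarrow> adj x y"
    "\<And>x. x \<in> V \<Longrightarrow> (\<Sum>y\<in>V. G x y) = \<beta> x - \<gamma> x" "(\<Sum>x\<in>V. \<Sum>y\<in>V. \<bar>G x y\<bar> powr q) \<le> d"
    by (rule transportsE) blast
  show ?thesis
  proof (rule transportsI[of "\<lambda>x y. F x y + G x y"])
    show "F x y + G x y = - (F y x + G y x)" for x y using F(1)[of x y] G(1)[of x y] by simp
    show "adj x y" if "F x y + G x y \<noteq> 0" for x y using F(2)[of x y] G(2)[of x y] that by fastforce
    show "(\<Sum>y\<in>V. F x y + G x y) = \<alpha> x - \<gamma> x" if "x \<in> V" for x
      using F(3)[OF that] G(3)[OF that] by (simp add: sum.distrib)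
    have "(\<Sum>x\<in>V. \<Sum>y\<in>V. \<bar>F x y + G x y\<bar> powr q)
        \<le> (\<Sum>x\<in>V. \<Sum>y\<in>V. 2 powr q * (\<bar>F x y\<bar> powr q + \<bar>G x y\<bar> powr q))"
      by (intro sum_mono abs_add_powr_le assms)
    also have "\<dots> = 2 powr q * ((\<Sum>x\<in>V. \<Sum>y\<in>V. \<bar>F x y\<bar> powr q) + (\<Sum>x\<in>V. \<Sum>y\<in>V. \<bar>G x y\<bar> powr q))"
      by (simp add: sum.distrib sum_distrib_left distrib_left)
    also have "\<dots> \<le> 2 powr q * (c + d)" using F(4) G(4) by (intro mult_left_mono) auto
    finally show "(\<Sum>x\<in>V. \<Sum>y\<in>V. \<bar>F x y + G x y\<bar> powr q) \<le> 2 powr q * (c + d)" .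
  qed
qed

text \<open>Flows are averaged along with their targets. The loss of \<open>card I\<close> comes
  from bounding a mean by a sum, and is harmless because the averages run over subsets of the flip
  group.\<close>

lemma transports_mean:
  assumes "finite I" "I \<noteq> {}" "0 < q" "\<And>i. i \<in> I \<Longrightarrow> transports q V adj c \<alpha> (\<beta> i)"
  shows "transports q V adj (real (card I) * c) \<alpha> (\<lambda>x. (\<Sum>i\<in>I. \<beta> i x) / card I)"
proof -
  have "\<forall>i\<in>I. \<exists>F. (\<forall>x y. F x y = - F y x) \<and> (\<forall>x y. F x y \<noteq> 0 \<longrightarrow> adj x y) \<and>
     (\<forall>x\<in>V. (\<Sum>y\<in>V. F x y) = \<alpha> x - \<beta> i x) \<and> (\<Sum>x\<in>V. \<Sum>y\<in>V. \<bar>F x y\<bar> powr q) \<le> c"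
    using assms(4) unfolding transports_def by blast
  from bchoice[OF this] obtain F where F: "\<forall>i\<in>I. (\<forall>x y. F i x y = - F i y x) \<and> (\<forall>x y. F i x y \<noteq> 0 \<longrightarrow> adj x y) \<and>
     (\<forall>x\<in>V. (\<Sum>y\<in>V. F i x y) = \<alpha> x - \<beta> i x) \<and> (\<Sum>x\<in>V. \<Sum>y\<in>V. \<bar>F i x y\<bar> powr q) \<le> c"
    by blast
  show ?thesis
  proof (rule transportsI[of "\<lambda>x y. (\<Sum>i\<in>I. F i x y) / card I"])
    have "(\<Sum>i\<in>I. F i x y) = - (\<Sum>i\<in>I. F i y x)" for x y
      unfolding sum_negf[symmetric] using F by (intro sum.cong refl) blast
    from this[of x y for x y]
    show "(\<Sum>i\<in>I. F i x y) / card I = - ((\<Sum>i\<in>I. F i y x) / card I)" for x y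
      unfolding minus_divide_left by (rule arg_cong)
    show "adj x y" if "(\<Sum>i\<in>I. F i x y) / card I \<noteq> 0" for x y
    proof -
      from that have "(\<Sum>i\<in>I. F i x y) \<noteq> 0" by auto
      then obtain i where "i \<in> I" "F i x y \<noteq> 0" by (meson sum.neutral)
      then show ?thesis using F by blast
    qed
    show "(\<Sum>y\<in>V. (\<Sum>i\<in>I. F i x y) / card I) = \<alpha> x - (\<Sum>i\<in>I. \<beta> i x) / card I" if "x \<in> V" for x
    proof -
      have "(\<Sum>y\<in>V. (\<Sum>i\<in>I. F i x y) / card I) = (\<Sum>i\<in>I. \<Sum>y\<in>V. F i x y) / card I"
        unfolding sum_divide_distrib[symmetric] by (subst sum.swap) simp
      also have "(\<Sum>i\<in>I. \<Sum>y\<in>V. F i x y) = (\<Sum>i\<in>I. \<alpha> x - \<beta> i x)"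
        using F that by (intro sum.cong refl) blast
      finally show ?thesis using assms by (simp add: sum_subtractf diff_divide_distrib)
    qed
    have "(\<Sum>x\<in>V. \<Sum>y\<in>V. \<bar>(\<Sum>i\<in>I. F i x y) / card I\<bar> powr q)
        \<le> (\<Sum>x\<in>V. \<Sum>y\<in>V. \<Sum>i\<in>I. \<bar>F i x y\<bar> powr q)"
      by (intro sum_mono abs_mean_powr_le assms)
    also have "\<dots> = (\<Sum>x\<in>V. \<Sum>i\<in>I. \<Sum>y\<in>V. \<bar>F i x y\<bar> powr q)"
      by (intro sum.cong refl sum.swap)
    also have "\<dots> = (\<Sum>i\<in>I. \<Sum>x\<in>V. \<Sum>y\<in>V. \<bar>F i x y\<bar> powr q)" by (rule sum.swap)
    also have "\<dots> \<le> real (card I) * c" using F by (intro sum_bounded_above) blast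
    finally show "(\<Sum>x\<in>V. \<Sum>y\<in>V. \<bar>(\<Sum>i\<in>I. F i x y) / card I\<bar> powr q) \<le> real (card I) * c" .
  qed
qed

text \<open>The divergences of an antisymmetric function cancel in pairs.\<close>

lemma transports_sum_eq:
  assumes "transports q V adj c \<alpha> \<beta>"
  shows "(\<Sum>x\<in>V. \<alpha> x) = (\<Sum>x\<in>V. \<beta> x)"
proof -
  from assms obtain F where F: "\<And>x y. F x y = - F y x"
    "\<And>x. x \<in> V \<Longrightarrow> (\<Sum>y\<in>V. F x y) = \<alpha> x - \<beta> x" by (rule transportsE) blast
  have "(\<Sum>x\<in>V. \<Sum>y\<in>V. F x y) = (\<Sum>x\<in>V. \<Sum>y\<in>V. - F y x)"
    by (intro sum.cong refl F(1))
  also have "\<dots> = - (\<Sum>x\<in>V. \<Sum>y\<in>V. F x y)" by (subst sum.swap) (simp add: sum_negf)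
  finally have "(\<Sum>x\<in>V. \<alpha> x - \<beta> x) = 0" using F(2) by simp
  then show ?thesis by (simp add: sum_subtractf)
qed

text \<open>The flow is pushed along \<open>\<phi>\<close> by summing over pairs of fibres. Fibres
  of size at most 2 let at most four values merge into one, whence \<open>4 powr q\<close>; edges
  inside a fibre may collapse, which is what folding needs.\<close>

lemma transports_push:
  assumes tr: "transports q V adj c \<alpha> \<beta>" and "finite V" "0 < q"
    and adj: "\<And>x y. adj x y \<Longrightarrow> x \<in> V \<and> y \<in> V"
    and maps: "\<phi> ` V \<subseteq> V"
    and hom: "\<And>x y. adj x y \<Longrightarrow> \<phi> x = \<phi> y \<or> adj (\<phi> x) (\<phi> y)"
    and fib: "\<And>x. card {x'\<in>V. \<phi> x' = x} \<le> 2"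
  shows "transports q V adj (4 powr q * c) (push V \<phi> \<alpha>) (push V \<phi> \<beta>)"
proof -
  from tr obtain F where F: "\<And>x y. F x y = - F y x" "\<And>x y. F x y \<noteq> 0 \<Longrightarrow> adj x y"
    "\<And>x. x \<in> V \<Longrightarrow> (\<Sum>y\<in>V. F x y) = \<alpha> x - \<beta> x" "(\<Sum>x\<in>V. \<Sum>y\<in>V. \<bar>F x y\<bar> powr q) \<le> c"
    by (rule transportsE) blast
  define fb where "fb x = {x'\<in>V. \<phi> x' = x}" for x
  have ffb: "finite (fb x)" for x using \<open>finite V\<close> by (simp add: fb_def)
  have group: "(\<Sum>x\<in>V. \<Sum>x'\<in>fb x. h x') = (\<Sum>x\<in>V. h x)" for h :: "'a \<Rightarrow> real"
    unfolding fb_def using \<open>finite V\<close> maps by (intro sum.group) auto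
  define G where "G x y = (\<Sum>x'\<in>fb x. \<Sum>y'\<in>fb y. F x' y')" for x y
  have G_anti: "G x y = - G y x" for x y
  proof -
    have "G x y = (\<Sum>x'\<in>fb x. \<Sum>y'\<in>fb y. - F y' x')"
      unfolding G_def by (intro sum.cong refl F(1))
    also have "\<dots> = - G y x" unfolding G_def by (subst sum.swap) (simp add: sum_negf)
    finally show ?thesis .
  qed
  show ?thesis
  proof (rule transportsI[of G, OF G_anti])
    show "adj x y" if "G x y \<noteq> 0" for x y
    proof -
      \<comment> \<open>Antisymmetry forces \<open>G x x = 0\<close>, so whatever flows inside a
        fibre leaves no trace and no loop edge is required.\<close>
      have "x \<noteq> y" using that G_anti[of x x] by auto
      from that obtain x' where x': "x' \<in> fb x" "(\<Sum>y'\<in>fb y. F x' y') \<noteq> 0"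
        unfolding G_def by (meson sum.neutral)
      then obtain y' where "y' \<in> fb y" "F x' y' \<noteq> 0" by (meson sum.neutral)
      then show ?thesis using x' F(2) hom[of x' y'] \<open>x \<noteq> y\<close> by (auto simp: fb_def)
    qed
    show "(\<Sum>y\<in>V. G x y) = push V \<phi> \<alpha> x - push V \<phi> \<beta> x" if "x \<in> V" for x
    proof -
      have "(\<Sum>y\<in>V. G x y) = (\<Sum>x'\<in>fb x. \<Sum>y\<in>V. \<Sum>y'\<in>fb y. F x' y')"
        unfolding G_def by (rule sum.swap)
      also have "\<dots> = (\<Sum>x'\<in>fb x. \<Sum>y\<in>V. F x' y)" by (simp add: group)
      also have "\<dots> = (\<Sum>x'\<in>fb x. \<alpha> x' - \<beta> x')" using F(3) by (intro sum.cong) (auto simp: fb_def)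
      finally show ?thesis by (simp add: push_def fb_def sum_subtractf)
    qed
    have "\<bar>G x y\<bar> powr q \<le> 4 powr q * (\<Sum>x'\<in>fb x. \<Sum>y'\<in>fb y. \<bar>F x' y'\<bar> powr q)" for x y
    proof -
      have "card (fb x) * card (fb y) \<le> 2 * 2"
        using fib unfolding fb_def by (intro mult_le_mono) auto
      then have "card (fb x \<times> fb y) \<le> 4" by (simp add: card_cartesian_product)
      then have "\<bar>\<Sum>z\<in>fb x \<times> fb y. F (fst z) (snd z)\<bar> powr q
          \<le> real 4 powr q * (\<Sum>z\<in>fb x \<times> fb y. \<bar>F (fst z) (snd z)\<bar> powr q)"
        using ffb \<open>0 < q\<close> by (intro abs_sum_powr_le) auto
      then show ?thesis unfolding G_def by (simp add: sum.cartesian_product split_beta)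
    qed
    then have "(\<Sum>x\<in>V. \<Sum>y\<in>V. \<bar>G x y\<bar> powr q)
        \<le> (\<Sum>x\<in>V. \<Sum>y\<in>V. 4 powr q * (\<Sum>x'\<in>fb x. \<Sum>y'\<in>fb y. \<bar>F x' y'\<bar> powr q))"
      by (intro sum_mono)
    also have "\<dots> = 4 powr q * (\<Sum>x\<in>V. \<Sum>y\<in>V. \<Sum>x'\<in>fb x. \<Sum>y'\<in>fb y. \<bar>F x' y'\<bar> powr q)"
      by (simp add: sum_distrib_left)
    also have "(\<Sum>x\<in>V. \<Sum>y\<in>V. \<Sum>x'\<in>fb x. \<Sum>y'\<in>fb y. \<bar>F x' y'\<bar> powr q)
        = (\<Sum>x\<in>V. \<Sum>x'\<in>fb x. \<Sum>y\<in>V. \<Sum>y'\<in>fb y. \<bar>F x' y'\<bar> powr q)"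
      by (intro sum.cong refl sum.swap)
    also have "\<dots> = (\<Sum>x\<in>V. \<Sum>y\<in>V. \<bar>F x y\<bar> powr q)" by (simp add: group)
    also have "4 powr q * \<dots> \<le> 4 powr q * c" using F(4) by (intro mult_left_mono) auto
    finally show "(\<Sum>x\<in>V. \<Sum>y\<in>V. \<bar>G x y\<bar> powr q) \<le> 4 powr q * c" by simp
  qed
qed

lemma sum_push:
  assumes "finite V" "\<phi> ` V \<subseteq> V"
  shows "(\<Sum>x\<in>V. push V \<phi> \<alpha> x) = (\<Sum>x\<in>V. \<alpha> x)"
  unfolding push_def using assms by (intro sum.group) auto

lemma push_inj:
  assumes "inj_on \<phi> V" "x \<in> V"
  shows "push V \<phi> \<alpha> (\<phi> x) = \<alpha> x"
proof -
  have "{x'\<in>V. \<phi> x' = \<phi> x} = {x}" using assms by (auto dest: inj_onD)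
  then show ?thesis by (simp add: push_def)
qed

lemma push_cong:
  assumes "\<And>x. x \<in> V \<Longrightarrow> \<alpha> x \<noteq> 0 \<Longrightarrow> \<phi> x = \<psi> x" "finite V"
  shows "push V \<phi> \<alpha> = push V \<psi> \<alpha>"
proof
  fix x
  have "push V \<phi> \<alpha> x = (\<Sum>x'\<in>V. if \<phi> x' = x then \<alpha> x' else 0)"
    unfolding push_def using assms(2) by (simp add: sum.inter_filter)
  also have "\<dots> = (\<Sum>x'\<in>V. if \<psi> x' = x then \<alpha> x' else 0)"
    using assms(1) by (intro sum.cong refl) metis
  also have "\<dots> = push V \<psi> \<alpha> x"
    unfolding push_def using assms(2) by (simp add: sum.inter_filter)
  finally show "push V \<phi> \<alpha> x = push V \<psi> \<alpha> x" .
qed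

lemma push_id_on:
  assumes "\<And>x. x \<in> V \<Longrightarrow> \<alpha> x \<noteq> 0 \<Longrightarrow> \<phi> x = x" "finite V" "x \<in> V"
  shows "push V \<phi> \<alpha> x = \<alpha> x"
proof -
  have "push V \<phi> \<alpha> = push V id \<alpha>" using assms by (intro push_cong) auto
  then show ?thesis using push_inj[of id V x \<alpha>] assms by simp
qed

lemma push_comp:
  assumes "finite V" "\<phi> ` V \<subseteq> V"
  shows "push V (\<psi> \<circ> \<phi>) \<alpha> = push V \<psi> (push V \<phi> \<alpha>)"
proof
  fix x
  have "(\<Sum>y\<in>{y\<in>V. \<psi> y = x}. push V \<phi> \<alpha> y)
      = (\<Sum>y\<in>{y\<in>V. \<psi> y = x}. \<Sum>z\<in>{z\<in>{z\<in>V. \<psi> (\<phi> z) = x}. \<phi> z = y}. \<alpha> z)"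
    unfolding push_def by (intro sum.cong) auto
  also have "\<dots> = (\<Sum>z\<in>{z\<in>V. \<psi> (\<phi> z) = x}. \<alpha> z)"
    using assms by (intro sum.group) auto
  finally show "push V (\<psi> \<circ> \<phi>) \<alpha> x = push V \<psi> (push V \<phi> \<alpha>) x"
    by (simp add: push_def)
qed

section \<open>Symmetries of the replacement graphs\<close>

text \<open>A dart \<open>(x, y, J)\<close> is an edge traversed from \<open>x\<close> to \<open>y\<close>, labelled by the gluing rule
  of its type read in that direction.\<close>

definition letter_darts :: "('a, 't) igs \<Rightarrow> ('a \<times> 'a \<times> ('a \<times> 'a) set) set" where
  "letter_darts R = {(a, b, igsI R (igsTyp R (a, b))) | a b. (a, b) \<in> igsE R}
     \<union> {(b, a, (igsI R (igsTyp R (a, b)))\<inverse>) | a b. (a, b) \<in> igsE R}"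

primrec darts :: "('a, 't) igs \<Rightarrow> nat \<Rightarrow> ('a list \<times> 'a list \<times> ('a \<times> 'a) set) set" where
  "darts R 0 = {}"
| "darts R (Suc m) = {(w @ [a], w @ [b], J) | w a b J. w \<in> words R m \<and> (a, b, J) \<in> letter_darts R}
     \<union> {(w @ [a], v @ [b], J) | w v a b J. (w, v, J) \<in> darts R m \<and> (a, b) \<in> J}"

lemma darts_iff_typed_edges:
  "(x, y, J) \<in> darts R m \<longleftrightarrow> (\<exists>t. ((x, y), t) \<in> typed_edges R m \<and> J = igsI R t
     \<or> ((y, x), t) \<in> typed_edges R m \<and> J = (igsI R t)\<inverse>)"
proof (induction m arbitrary: x y J)
  case (Suc m)
  show ?case (is "?L \<longleftrightarrow> ?R")
  proof
    assume ?L
    then show ?R by (auto simp: letter_darts_def Suc)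
  next
    assume ?R
    then show ?L by (auto simp: letter_darts_def Suc)
  qed
qed auto

abbreviation adj :: "('a, 't) igs \<Rightarrow> nat \<Rightarrow> 'a list \<Rightarrow> 'a list \<Rightarrow> bool" where
  "adj R m \<equiv> uedge (edges R m)"

lemma adj_iff_darts: "adj R m x y \<longleftrightarrow> (\<exists>J. (x, y, J) \<in> darts R m)"
proof -
  have "(x, y) \<in> edges R m \<longleftrightarrow> (\<exists>t. ((x, y), t) \<in> typed_edges R m)" for x y
    by (force simp: edges_def)
  then show ?thesis by (auto simp: uedge_def darts_iff_typed_edges)
qed

text \<open>Edges may be reversed and types may be permuted; only the labelled darts must be
  preserved. As the label alone decides how a dart is refined, this condition on single letters
  passes to all levels.\<close>

definition automorphism :: "('a, 't) igs \<Rightarrow> ('a \<Rightarrow> 'a) \<Rightarrow> bool" where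
  "automorphism R g \<longleftrightarrow> g permutes igsS R \<and>
     (\<forall>a b J. (a, b, J) \<in> letter_darts R \<longrightarrow> (g a, g b, map_prod g g ` J) \<in> letter_darts R)"

text \<open>The values of \<open>igsEta\<close> outside the alphabet carry no meaning (for the
  carpet they are residues mod 5). Resetting them to the identity yields a permutation of the
  alphabet in the sense of \<open>permutes\<close>, so that products of flips can be compared as
  functions.\<close>

definition flip :: "('a, 't) igs \<Rightarrow> 't \<Rightarrow> 'a \<Rightarrow> 'a" where
  "flip R t x = (if x \<in> igsS R then igsEta R t x else x)"

lemma words_snoc: "w @ [a] \<in> words R (Suc m) \<longleftrightarrow> w \<in> words R m \<and> a \<in> igsS R"
  by (auto simp: words_def)

lemma words_SucE:
  assumes "x \<in> words R (Suc m)"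
  obtains w a where "x = w @ [a]" "w \<in> words R m" "a \<in> igsS R"
  using assms by (cases x rule: rev_cases) (auto simp: words_def)

text \<open>The uniqueness, \<open>Domain\<close> and \<open>single_valued\<close> conditions serve
  to bound the degree of every \<open>G_m\<close>; connected letters together with nonempty labels
  make every \<open>G_m\<close> connected; the remaining conditions let the flips act on
  gates.\<close>

locale flip_symmetric_igs =
  fixes R :: "('a, 't) igs"
  assumes finite_letters: "finite (igsS R)"
    and finite_letter_darts: "finite (letter_darts R)"
    and letter_dart: "(a, b, J) \<in> letter_darts R \<Longrightarrow>
      a \<in> igsS R \<and> b \<in> igsS R \<and> a \<noteq> b \<and> J \<noteq> {} \<and> J \<subseteq> igsS R \<times> igsS R"
    and letter_dart_unique: "(a, b, J) \<in> letter_darts R \<Longrightarrow> (a, b', J) \<in> letter_darts R \<Longrightarrow> b = b'"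
    and letter_dart_Domain: "(a, b, J) \<in> letter_darts R \<Longrightarrow> a \<notin> Domain J"
    and letter_dart_single_valued: "(a, b, J) \<in> letter_darts R \<Longrightarrow> single_valued J"
    and letters_connected:
      "a \<in> igsS R \<Longrightarrow> b \<in> igsS R \<Longrightarrow> (\<lambda>a b. \<exists>J. (a, b, J) \<in> letter_darts R)\<^sup>*\<^sup>* a b"
    and finite_types: "finite (igsT R)"
    and gate: "t \<in> igsT R \<Longrightarrow> Ipm R t s \<subseteq> igsS R \<and> Ipm R t s \<noteq> {}"
    and gates_disjoint: "t \<in> igsT R \<Longrightarrow> Ipm R t False \<inter> Ipm R t True = {}"
    and flip_automorphism: "t \<in> igsT R \<Longrightarrow> automorphism R (flip R t)"
    and flip_gate: "t \<in> igsT R \<Longrightarrow> flip R t ` Ipm R t s = Ipm R t (\<not> s)"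
begin

section \<open>Degree of the replacement graphs\<close>

lemma finite_words: "finite (words R m)"
  unfolding words_def using finite_lists_length_eq[OF finite_letters, of m]
  by (simp add: conj_commute)

lemma darts_words:
  "(x, y, J) \<in> darts R m \<Longrightarrow> x \<in> words R m \<and> y \<in> words R m \<and> x \<noteq> y \<and> (\<exists>a b. (a, b, J) \<in> letter_darts R)"
proof (induction m arbitrary: x y J)
  case (Suc m)
  from Suc.prems consider
    w a b where "x = w @ [a]" "y = w @ [b]" "w \<in> words R m" "(a, b, J) \<in> letter_darts R"
    | w v a b where "x = w @ [a]" "y = v @ [b]" "(w, v, J) \<in> darts R m" "(a, b) \<in> J"
    by auto
  then show ?case
  proof cases
    case 1
    then show ?thesis using letter_dart by (auto simp: words_snoc)
  next
    case 2
    then have "w \<in> words R m" "v \<in> words R m" "w \<noteq> v" and J: "\<exists>a b. (a, b, J) \<in> letter_darts R"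
      using Suc.IH by blast+
    moreover from J have "J \<subseteq> igsS R \<times> igsS R" using letter_dart by blast
    ultimately show ?thesis using 2 by (auto simp: words_snoc)
  qed
qed auto

lemma adj_words: "adj R m x y \<Longrightarrow> x \<in> words R m \<and> y \<in> words R m"
  unfolding adj_iff_darts using darts_words by blast

lemma adj_sym: "adj R m x y \<Longrightarrow> adj R m y x"
  by (auto simp: uedge_def)

lemma edges_subset: "edges R m \<subseteq> words R m \<times> words R m"
  using adj_words by (auto simp: uedge_def)

text \<open>A dart out of \<open>w @ [a]\<close> with label \<open>J\<close> that stays in the cell
  of w excludes a from \<open>Domain J\<close>, so for given source and label only one of the two
  generation rules can apply. Within each rule the target is determined.\<close>

lemma darts_unique: "(x, y, J) \<in> darts R m \<Longrightarrow> (x, y', J) \<in> darts R m \<Longrightarrow> y = y'"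
proof (induction m arbitrary: x y y' J)
  case (Suc m)
  have J: "\<exists>a b. (a, b, J) \<in> letter_darts R" using darts_words Suc.prems(1) by blast
  then have sv: "b = b'" if "(a, b) \<in> J" "(a, b') \<in> J" for a b b'
    using letter_dart_single_valued that by (blast dest: single_valuedD)
  from Suc.prems(1) consider
    w a b where "x = w @ [a]" "y = w @ [b]" "(a, b, J) \<in> letter_darts R"
    | w v a b where "x = w @ [a]" "y = v @ [b]" "(w, v, J) \<in> darts R m" "(a, b) \<in> J"
    by auto
  then show ?case
  proof cases
    case 1
    then show ?thesis using Suc.prems(2) letter_dart_unique letter_dart_Domain by auto blast+
  next
    case 2
    then obtain v' b' where "y' = v' @ [b']" "(w, v', J) \<in> darts R m" "(a, b') \<in> J"
      using Suc.prems(2) letter_dart_Domain by auto blast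
    then show ?thesis using 2 Suc.IH[of w v J v'] sv[of a b b'] by simp
  qed
qed auto

text \<open>Neighbours of x are determined by labels of darts, and every label already occurs on a
  letter dart; hence the bound does not involve m.\<close>

lemma card_adj_le: "card {y. adj R m x y} \<le> card (letter_darts R)"
proof -
  have "{y. adj R m x y} \<subseteq> (\<lambda>(a, b, J). THE y. (x, y, J) \<in> darts R m) ` letter_darts R"
  proof
    fix y assume "y \<in> {y. adj R m x y}"
    then obtain J where J: "(x, y, J) \<in> darts R m" by (auto simp: adj_iff_darts)
    then have "(THE y. (x, y, J) \<in> darts R m) = y" using darts_unique by blast
    moreover obtain a b where "(a, b, J) \<in> letter_darts R" using darts_words[OF J] by blast
    ultimately show "y \<in> (\<lambda>(a, b, J). THE y. (x, y, J) \<in> darts R m) ` letter_darts R"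
      by (intro image_eqI[of _ _ "(a, b, J)"]) auto
  qed
  then show ?thesis
    using finite_letter_darts by (meson card_image_le card_mono finite_imageI order_trans)
qed

section \<open>Lifting automorphisms from letters to words\<close>

lemma automorphism_words:
  assumes "automorphism R g"
  shows "bij_betw (map g) (words R m) (words R m)"
proof -
  from assms have g: "g permutes igsS R" by (simp add: automorphism_def)
  have inj: "inj_on (map g) (words R m)"
    using permutes_inj[OF g] by (meson inj_mapI inj_on_subset subset_UNIV)
  moreover have "map g ` words R m \<subseteq> words R m"
    using permutes_in_image[OF g] by (auto simp: words_def subset_iff)
  ultimately show ?thesis
    by (simp add: bij_betw_def endo_inj_surj finite_words)
qed

text \<open>The label has to be carried through the induction: the second generation rule refines a
  dart by a pair from its label, and the image pair lies in the image label.\<close>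

lemma automorphism_darts:
  assumes g: "automorphism R g"
  shows "(x, y, J) \<in> darts R m \<Longrightarrow> (map g x, map g y, map_prod g g ` J) \<in> darts R m"
proof (induction m arbitrary: x y J)
  case (Suc m)
  from Suc.prems consider
    w a b where "x = w @ [a]" "y = w @ [b]" "w \<in> words R m" "(a, b, J) \<in> letter_darts R"
    | w v a b where "x = w @ [a]" "y = v @ [b]" "(w, v, J) \<in> darts R m" "(a, b) \<in> J"
    by auto
  then show ?case
  proof cases
    case 1
    moreover have "map g w \<in> words R m"
      using 1 automorphism_words[OF g] by (auto simp: bij_betw_def)
    moreover have "(g a, g b, map_prod g g ` J) \<in> letter_darts R"
      using 1 g by (simp add: automorphism_def)
    ultimately show ?thesis by auto
  next
    case 2
    moreover have "(g a, g b) \<in> map_prod g g ` J" using 2 by force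
    ultimately show ?thesis using Suc.IH by fastforce
  qed
qed auto

lemma automorphism_adj: "automorphism R g \<Longrightarrow> adj R m x y \<Longrightarrow> adj R m (map g x) (map g y)"
  using automorphism_darts unfolding adj_iff_darts by blast

lemma transports_push_words:
  assumes "transports q (words R m) (adj R m) c \<alpha> \<beta>" "0 < q" "\<phi> ` words R m \<subseteq> words R m"
    and "\<And>x y. adj R m x y \<Longrightarrow> \<phi> x = \<phi> y \<or> adj R m (\<phi> x) (\<phi> y)"
    and "\<And>x. card {x'\<in>words R m. \<phi> x' = x} \<le> 2"
  shows "transports q (words R m) (adj R m) (4 powr q * c)
    (push (words R m) \<phi> \<alpha>) (push (words R m) \<phi> \<beta>)"
  using assms adj_words by (intro transports_push finite_words) blast+

lemma transports_automorphism:
  assumes "transports q (words R m) (adj R m) c \<alpha> \<beta>" "0 < q" "automorphism R g"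
  shows "transports q (words R m) (adj R m) (4 powr q * c)
    (push (words R m) (map g) \<alpha>) (push (words R m) (map g) \<beta>)"
proof (rule transports_push_words[OF assms(1,2)])
  have bij: "bij_betw (map g) (words R m) (words R m)" by (rule automorphism_words[OF assms(3)])
  then show "map g ` words R m \<subseteq> words R m" by (simp add: bij_betw_def)
  show "map g x = map g y \<or> adj R m (map g x) (map g y)" if "adj R m x y" for x y
    using automorphism_adj[OF assms(3) that] ..
  show "card {x' \<in> words R m. map g x' = x} \<le> 2" for x
  proof -
    have "\<exists>y. {x' \<in> words R m. map g x' = x} \<subseteq> {y}"
      using bij by (auto simp: bij_betw_def dest: inj_onD)
    then obtain y where "{x' \<in> words R m. map g x' = x} \<subseteq> {y}" ..
    then have "card {x' \<in> words R m. map g x' = x} \<le> card {y}" by (intro card_mono) auto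
    then show ?thesis by simp
  qed
qed

text \<open>Each cell is a copy of the connected \<open>G_1\<close>, and adjacent cells are joined
  because labels are nonempty.\<close>

lemma words_connected:
  "x \<in> words R m \<Longrightarrow> y \<in> words R m \<Longrightarrow> (adj R m)\<^sup>*\<^sup>* x y"
proof (induction m arbitrary: x y)
  case 0
  then show ?case by (simp add: words_def)
next
  case (Suc m)
  have same: "(adj R (Suc m))\<^sup>*\<^sup>* (w @ [a]) (w @ [b])"
    if "w \<in> words R m" "a \<in> igsS R" "b \<in> igsS R" for w a b
    using letters_connected[OF that(2,3)]
  proof (induction rule: rtranclp_induct)
    case (step b c)
    then have "adj R (Suc m) (w @ [b]) (w @ [c])"
      using that(1) by (auto simp: adj_iff_darts)
    then show ?case using step.IH by simp
  qed simp
  \<comment> \<open>All last letters are reached at once, because the letter at which the path must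
    leave the cell of v is dictated by the label of the next dart.\<close>
  have ext: "\<forall>b\<in>igsS R. (adj R (Suc m))\<^sup>*\<^sup>* (w @ [a]) (v @ [b])"
    if "(adj R m)\<^sup>*\<^sup>* w v" "w \<in> words R m" "a \<in> igsS R" for w v a
    using that(1)
  proof (induction rule: rtranclp_induct)
    case base
    then show ?case using same that by blast
  next
    case (step v u)
    then obtain J where J: "(v, u, J) \<in> darts R m" by (auto simp: adj_iff_darts)
    from darts_words[OF J] letter_dart obtain c d where cd: "(c, d) \<in> J" "c \<in> igsS R" "d \<in> igsS R"
      by blast
    have "adj R (Suc m) (v @ [c]) (u @ [d])" using J cd by (auto simp: adj_iff_darts)
    then have "(adj R (Suc m))\<^sup>*\<^sup>* (w @ [a]) (u @ [d])" using step.IH cd(2) by auto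
    then show ?case using cd(3) same darts_words[OF J] by (meson rtranclp_trans)
  qed
  from Suc.prems obtain w a v b where "x = w @ [a]" "w \<in> words R m" "a \<in> igsS R"
    and "y = v @ [b]" "v \<in> words R m" "b \<in> igsS R"
    by (metis words_SucE)
  then show ?case using ext[of w v a] Suc.IH[of w v] by simp
qed

text \<open>The constant is uncontrolled: the lemma only serves to show that the sets of unit flows
  are nonempty, so that their infima are meaningful.\<close>

lemma dirac_transports:
  assumes "x \<in> words R m" "y \<in> words R m" "0 < q"
  shows "\<exists>c. transports q (words R m) (adj R m) c (\<lambda>z. of_bool (z = x)) (\<lambda>z. of_bool (z = y))"
  using words_connected[OF assms(1,2)]
proof (induction rule: rtranclp_induct)
  case base
  show ?case by (rule exI, rule transports_refl)
next
  case (step y z)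
  note yz = adj_words[OF step(2)]
  define F :: "'a list \<Rightarrow> 'a list \<Rightarrow> real" where
    "F u v = of_bool (u = y \<and> v = z) - of_bool (u = z \<and> v = y)" for u v
  have "transports q (words R m) (adj R m) (\<Sum>x\<in>words R m. \<Sum>y\<in>words R m. \<bar>F x y\<bar> powr q)
      (\<lambda>u. of_bool (u = y)) (\<lambda>u. of_bool (u = z))"
  proof (rule transportsI[of F])
    show "F u v = - F v u" for u v by (simp add: F_def conj_commute)
    show "adj R m u v" if "F u v \<noteq> 0" for u v
      using that step(2) adj_sym[OF step(2)] by (auto simp: F_def of_bool_def split: if_splits)
    show "(\<Sum>v\<in>words R m. F u v) = of_bool (u = y) - of_bool (u = z)" for u
      unfolding F_def of_bool_conj sum_subtractf sum_distrib_left[symmetric]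
      using yz finite_words by (simp add: of_bool_def)
  qed simp
  from transports_trans[OF _ this \<open>0 < q\<close>] show ?case using step.IH by (elim exE) (rule exI)
qed

section \<open>Passing between unit flows and transports\<close>

lemma flow_div_eq_sum:
  assumes "is_antisym_fun (edges R m) F"
  shows "flow_div (edges R m) F x = (\<Sum>y\<in>words R m. F x y)"
proof -
  have "F x y = 0" if "\<not> adj R m x y" for x y
    using assms that unfolding is_antisym_fun_def by blast
  then show ?thesis
    unfolding flow_div_def using adj_words finite_words by (intro sum.mono_neutral_left) auto
qed

text \<open>The source distribution is the divergence on A, the sink distribution is minus the
  divergence on B. The energy doubles because \<open>transports\<close> counts both directions of
  each edge.\<close>

lemma unit_flow_transports:
  assumes F: "is_unit_flow (words R m) (edges R m) A B F"
  obtains \<alpha> \<beta> where "\<forall>x. x \<notin> A \<longrightarrow> \<alpha> x = 0" "\<forall>x. x \<notin> B \<longrightarrow> \<beta> x = 0"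
    "(\<Sum>x\<in>words R m. \<alpha> x) = 1"
    "transports q (words R m) (adj R m) (2 * flow_energy q (edges R m) F) \<alpha> \<beta>"
proof -
  have anti: "is_antisym_fun (edges R m) F" and AB: "A \<subseteq> words R m" "A \<inter> B = {}"
    and div: "\<And>x. x \<in> words R m \<Longrightarrow> x \<notin> A \<union> B \<Longrightarrow> flow_div (edges R m) F x = 0"
    and one: "(\<Sum>x\<in>A. flow_div (edges R m) F x) = 1"
    using F by (auto simp: is_unit_flow_def is_flow_def)
  define \<alpha> where "\<alpha> x = (if x \<in> A then flow_div (edges R m) F x else 0)" for x
  define \<beta> where "\<beta> x = (if x \<in> B then - flow_div (edges R m) F x else 0)" for x
  show thesis
  proof (rule that[of \<alpha> \<beta>])
    have "(\<Sum>x\<in>words R m. \<alpha> x) = (\<Sum>x\<in>A. \<alpha> x)"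
      using AB finite_words by (intro sum.mono_neutral_right) (auto simp: \<alpha>_def)
    then show "(\<Sum>x\<in>words R m. \<alpha> x) = 1" using one by (simp add: \<alpha>_def)
    show "transports q (words R m) (adj R m) (2 * flow_energy q (edges R m) F) \<alpha> \<beta>"
    proof (rule transportsI[of F])
      show "F x y = - F y x" for x y using anti unfolding is_antisym_fun_def by blast
      show "adj R m x y" if "F x y \<noteq> 0" for x y using anti that unfolding is_antisym_fun_def by blast
      show "(\<Sum>y\<in>words R m. F x y) = \<alpha> x - \<beta> x" if "x \<in> words R m" for x
        using div[OF that] AB by (auto simp: \<alpha>_def \<beta>_def flow_div_eq_sum[OF anti, symmetric])
      have zero: "F x y = 0" if "\<not> adj R m x y" for x y
        using anti that unfolding is_antisym_fun_def by blast
      have fin: "finite (edges R m)"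
        using edges_subset finite_words by (meson finite_SigmaI finite_subset)
      have "(\<Sum>x\<in>words R m. \<Sum>y\<in>words R m. \<bar>F x y\<bar> powr q)
          = (\<Sum>(x, y)\<in>words R m \<times> words R m. \<bar>F x y\<bar> powr q)"
        by (rule sum.cartesian_product)
      also have "\<dots> = (\<Sum>(x, y)\<in>edges R m \<union> (edges R m)\<inverse>. \<bar>F x y\<bar> powr q)"
        using edges_subset[of m] zero[unfolded uedge_def] finite_words
        by (intro sum.mono_neutral_right) (blast, blast, force)
      also have "\<dots> \<le> (\<Sum>(x, y)\<in>edges R m. \<bar>F x y\<bar> powr q) + (\<Sum>(x, y)\<in>(edges R m)\<inverse>. \<bar>F x y\<bar> powr q)"
        using fin by (simp add: sum_Un sum_nonneg case_prod_beta)
      also have "(\<Sum>(x, y)\<in>(edges R m)\<inverse>. \<bar>F x y\<bar> powr q) = (\<Sum>(x, y)\<in>edges R m. \<bar>F y x\<bar> powr q)"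
        by (rule sum.reindex_bij_witness[of _ prod.swap prod.swap]) auto
      also have "\<dots> = (\<Sum>(x, y)\<in>edges R m. \<bar>F x y\<bar> powr q)"
      proof (intro sum.cong refl, clarsimp)
        fix x y
        have "F y x = - F x y" using anti unfolding is_antisym_fun_def by blast
        then show "\<bar>F y x\<bar> powr q = \<bar>F x y\<bar> powr q" by simp
      qed
      finally show "(\<Sum>x\<in>words R m. \<Sum>y\<in>words R m. \<bar>F x y\<bar> powr q)
          \<le> 2 * flow_energy q (edges R m) F" by (simp add: flow_energy_def)
    qed
  qed (auto simp: \<alpha>_def \<beta>_def)
qed

lemma flow_energy_le_sum:
  "flow_energy q (edges R m) F \<le> (\<Sum>x\<in>words R m. \<Sum>y\<in>words R m. \<bar>F x y\<bar> powr q)"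
  unfolding flow_energy_def sum.cartesian_product
  using edges_subset finite_words by (intro sum_mono2) auto

lemma transports_unit_flow:
  assumes tr: "transports q (words R m) (adj R m) c \<alpha> \<beta>"
    and AB: "A \<subseteq> words R m" "B \<subseteq> words R m" "A \<noteq> {}" "B \<noteq> {}" "A \<inter> B = {}"
    and supp: "\<And>x. x \<notin> A \<Longrightarrow> \<alpha> x = 0" "\<And>x. x \<notin> B \<Longrightarrow> \<beta> x = 0"
    and one: "(\<Sum>x\<in>words R m. \<alpha> x) = 1"
  obtains F where "is_unit_flow (words R m) (edges R m) A B F" "flow_energy q (edges R m) F \<le> c"
proof -
  from tr obtain F where F: "\<And>x y. F x y = - F y x" "\<And>x y. F x y \<noteq> 0 \<Longrightarrow> adj R m x y"
    "\<And>x. x \<in> words R m \<Longrightarrow> (\<Sum>y\<in>words R m. F x y) = \<alpha> x - \<beta> x"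
    "(\<Sum>x\<in>words R m. \<Sum>y\<in>words R m. \<bar>F x y\<bar> powr q) \<le> c"
    by (rule transportsE) blast
  have anti: "is_antisym_fun (edges R m) F"
    unfolding is_antisym_fun_def using F(1,2) by blast
  have div: "flow_div (edges R m) F x = \<alpha> x - \<beta> x" if "x \<in> words R m" for x
    using F(3)[OF that] flow_div_eq_sum[OF anti] by simp
  have "(\<Sum>x\<in>A. flow_div (edges R m) F x) = (\<Sum>x\<in>A. \<alpha> x)"
    using div AB supp(2) by (intro sum.cong refl) (metis IntI diff_zero empty_iff subsetD)
  also have "\<dots> = (\<Sum>x\<in>words R m. \<alpha> x)"
    using AB finite_words supp by (intro sum.mono_neutral_left) auto
  finally have "is_unit_flow (words R m) (edges R m) A B F"
    using AB supp div anti one by (simp add: is_unit_flow_def is_flow_def)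
  moreover have "flow_energy q (edges R m) F \<le> c"
    using flow_energy_le_sum F(4) by (rule order_trans)
  ultimately show thesis by (rule that)
qed

end

section \<open>From symmetric distributions to flow bases\<close>

text \<open>Products of generators suffice: in a finite set of permutations closed under
  composition, inverses come for free.\<close>

inductive_set flip_group :: "('a, 't) igs \<Rightarrow> ('a \<Rightarrow> 'a) set" for R where
  id: "id \<in> flip_group R"
| flip: "t \<in> igsT R \<Longrightarrow> g \<in> flip_group R \<Longrightarrow> flip R t \<circ> g \<in> flip_group R"

text \<open>Extends a flow \<open>H\<close> on \<open>G_m\<close> to the augmented graph, where \<open>b L v\<close> is the amount
  sent from \<open>v_L\<close> to \<open>v\<close>.\<close>

definition extend_flow ::
    "('a list \<Rightarrow> 'a list \<Rightarrow> real) \<Rightarrow> ('a list set \<Rightarrow> 'a list \<Rightarrow> real) \<Rightarrow> 'a tvert \<Rightarrow> 'a tvert \<Rightarrow> real" where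
  "extend_flow H b x y = (case x of
      Inl u \<Rightarrow> (case y of Inl v \<Rightarrow> H u v | Inr (L, v) \<Rightarrow> if u = v then - b L v else 0)
    | Inr (L, u) \<Rightarrow> (case y of Inl v \<Rightarrow> if u = v then b L u else 0 | Inr _ \<Rightarrow> 0))"

lemma map_image_words:
  "map g ` {w. length w = m \<and> set w \<subseteq> A} = {w. length w = m \<and> set w \<subseteq> g ` A}"
proof (intro equalityI subsetI)
  fix w assume w: "w \<in> {w. length w = m \<and> set w \<subseteq> g ` A}"
  then have "w \<in> lists (g ` A)" by auto
  then obtain v where "w = map g v" "v \<in> lists A" by (auto simp: lists_image)
  then show "w \<in> map g ` {w. length w = m \<and> set w \<subseteq> A}" using w by auto
qed (auto simp: subset_iff)

lemma map_image_Ipow: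
  assumes "g ` Ipm R t s = Ipm R t' s'"
  shows "map g ` Ipow R m t s = Ipow R m t' s'"
  unfolding Ipow_def map_image_words assms ..

lemma uedge_tedges_Inl_Inl: "uedge (tedges R m) (Inl u) (Inl v) \<longleftrightarrow> adj R m u v"
  by (auto simp: uedge_def tedges_def)

lemma uedge_tedges_Inr_Inl:
  "uedge (tedges R m) (Inr (L, u)) (Inl v) \<longleftrightarrow> L \<in> Lsets R m \<and> v \<in> L \<and> u = v"
  by (auto simp: uedge_def tedges_def)

lemma uedge_tedges_Inl_Inr:
  "uedge (tedges R m) (Inl v) (Inr (L, u)) \<longleftrightarrow> L \<in> Lsets R m \<and> v \<in> L \<and> u = v"
  by (auto simp: uedge_def tedges_def)

lemma uedge_tedges_Inr_Inr: "\<not> uedge (tedges R m) (Inr z) (Inr z')"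
  by (auto simp: uedge_def tedges_def)

context flip_symmetric_igs
begin

section \<open>Gates and the size of source distributions\<close>

lemma finite_Lsets: "finite (Lsets R m)"
proof -
  have "Lsets R m = (\<lambda>(t, s). Ipow R m t s) ` (igsT R \<times> UNIV)" by (auto simp: Lsets_def)
  then show ?thesis using finite_types by simp
qed

lemma Ipow_subset_words: "t \<in> igsT R \<Longrightarrow> Ipow R m t s \<subseteq> words R m"
  using gate[of t s] by (auto simp: Ipow_def words_def)

lemma Ipow_nonempty:
  assumes "t \<in> igsT R" shows "Ipow R m t s \<noteq> {}"
proof -
  from gate[OF assms] obtain a where "a \<in> Ipm R t s" by blast
  then have "replicate m a \<in> Ipow R m t s" by (auto simp: Ipow_def)
  then show ?thesis by blast
qed

text \<open>The first letter separates the two gates. For m = 0 both consist of the empty word,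
  which is why m starts at 1.\<close>

lemma Ipow_disjoint:
  assumes "t \<in> igsT R" "1 \<le> m" shows "Ipow R m t False \<inter> Ipow R m t True = {}"
proof -
  have False if "length w = m" "set w \<subseteq> Ipm R t False" "set w \<subseteq> Ipm R t True" for w
    using that assms gates_disjoint[of t] by (cases w) auto
  then show ?thesis by (auto simp: Ipow_def)
qed

lemma Lsets_subset_words: "L \<in> Lsets R m \<Longrightarrow> L \<subseteq> words R m \<and> L \<noteq> {}"
  using Ipow_subset_words Ipow_nonempty by (auto simp: Lsets_def)

text \<open>Wherever \<open>\<alpha>\<close> is nonzero it equals the divergence of the flow, a sum
  over boundedly many edges.\<close>

lemma source_powr_le:
  assumes "transports q (words R m) (adj R m) c \<alpha> \<beta>" "0 < q" "\<And>x. \<alpha> x = 0 \<or> \<beta> x = 0"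
  shows "(\<Sum>x\<in>words R m. \<bar>\<alpha> x\<bar> powr q) \<le> real (card (letter_darts R)) powr q * c"
proof -
  from assms(1) obtain F where F: "\<And>x y. F x y = - F y x" "\<And>x y. F x y \<noteq> 0 \<Longrightarrow> adj R m x y"
    "\<And>x. x \<in> words R m \<Longrightarrow> (\<Sum>y\<in>words R m. F x y) = \<alpha> x - \<beta> x"
    "(\<Sum>x\<in>words R m. \<Sum>y\<in>words R m. \<bar>F x y\<bar> powr q) \<le> c"
    by (rule transportsE) blast
  have "\<bar>\<alpha> x\<bar> powr q \<le> real (card (letter_darts R)) powr q * (\<Sum>y\<in>words R m. \<bar>F x y\<bar> powr q)"
    if x: "x \<in> words R m" for x
  proof -
    have sub: "{y. adj R m x y} \<subseteq> words R m" using adj_words by blast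
    then have fin: "finite {y. adj R m x y}" using finite_words finite_subset by blast
    have "\<bar>\<alpha> x\<bar> \<le> \<bar>\<Sum>y\<in>words R m. F x y\<bar>" using F(3)[OF x] assms(3)[of x] by auto
    also have "(\<Sum>y\<in>words R m. F x y) = (\<Sum>y\<in>{y. adj R m x y}. F x y)"
      using sub finite_words F(2) by (intro sum.mono_neutral_right) blast+
    finally have "\<bar>\<alpha> x\<bar> powr q \<le> \<bar>\<Sum>y\<in>{y. adj R m x y}. F x y\<bar> powr q"
      using \<open>0 < q\<close> by (intro powr_mono2) auto
    also have "\<dots> \<le> real (card (letter_darts R)) powr q * (\<Sum>y\<in>{y. adj R m x y}. \<bar>F x y\<bar> powr q)"
      by (intro abs_sum_powr_le fin card_adj_le \<open>0 < q\<close>)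
    also have "\<dots> \<le> real (card (letter_darts R)) powr q * (\<Sum>y\<in>words R m. \<bar>F x y\<bar> powr q)"
      using sub finite_words by (intro mult_left_mono sum_mono2) auto
    finally show ?thesis .
  qed
  then have "(\<Sum>x\<in>words R m. \<bar>\<alpha> x\<bar> powr q)
      \<le> (\<Sum>x\<in>words R m. real (card (letter_darts R)) powr q * (\<Sum>y\<in>words R m. \<bar>F x y\<bar> powr q))"
    by (rule sum_mono)
  also have "\<dots> \<le> real (card (letter_darts R)) powr q * c"
    unfolding sum_distrib_left[symmetric] using F(4) by (intro mult_left_mono) auto
  finally show ?thesis .
qed

section \<open>The group generated by the flips\<close>

lemma automorphism_id: "automorphism R id"
  by (simp add: automorphism_def permutes_id map_prod.id)

lemma automorphism_comp:
  assumes "automorphism R g" "automorphism R h" shows "automorphism R (g \<circ> h)"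
proof -
  have "map_prod (g \<circ> h) (g \<circ> h) ` J = map_prod g g ` map_prod h h ` J" for J
    by (simp add: image_comp map_prod.comp)
  then show ?thesis using assms by (simp add: automorphism_def permutes_compose)
qed

lemma flip_group_automorphism: "g \<in> flip_group R \<Longrightarrow> automorphism R g"
  by (induction rule: flip_group.induct)
    (intro automorphism_id automorphism_comp flip_automorphism; assumption)+

lemma finite_flip_group: "finite (flip_group R)"
proof (rule finite_subset)
  show "flip_group R \<subseteq> {g. g permutes igsS R}"
    using flip_group_automorphism by (auto simp: automorphism_def)
qed (rule finite_permutations[OF finite_letters])

lemma map_flip: "v \<in> words R m \<Longrightarrow> map (flip R t) v = flipw R t v"
  by (auto simp: flipw_def flip_def words_def)

text \<open>Left translation is an injective self-map of a finite set, hence onto. This makes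
  averages over the group equivariant.\<close>

lemma flip_comp_flip_group:
  assumes "t \<in> igsT R" shows "(\<lambda>g. flip R t \<circ> g) ` flip_group R = flip_group R"
proof (rule endo_inj_surj[OF finite_flip_group])
  show "(\<lambda>g. flip R t \<circ> g) ` flip_group R \<subseteq> flip_group R"
    using flip_group.flip[OF assms] by blast
  have "inj (flip R t)"
    using flip_automorphism[OF assms] permutes_inj by (auto simp: automorphism_def)
  then show "inj_on (\<lambda>g. flip R t \<circ> g) (flip_group R)"
    by (intro inj_onI ext) (metis comp_apply injD)
qed

text \<open>The divergence of H at an old vertex is supplied through the new edges of L1 and drained
  through those of L2. All other gates get coefficient 0, so (FB2) is built in.\<close>

lemma extend_flow_unit_flow:
  assumes L: "L1 \<in> Lsets R m" "L2 \<in> Lsets R m" "L1 \<noteq> L2"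
    and H: "\<And>x y. H x y = - H y x" "\<And>x y. H x y \<noteq> 0 \<Longrightarrow> adj R m x y"
      "\<And>x. x \<in> words R m \<Longrightarrow> (\<Sum>y\<in>words R m. H x y) = \<nu> L1 x - \<nu> L2 x"
    and supp: "\<And>L v. L \<in> Lsets R m \<Longrightarrow> v \<notin> L \<Longrightarrow> \<nu> L v = 0"
    and one: "(\<Sum>x\<in>words R m. \<nu> L1 x) = 1"
  shows "is_unit_flow (tverts R m) (tedges R m) (tilde L1) (tilde L2)
    (extend_flow H (\<lambda>L v. of_bool (L = L1) * \<nu> L v - of_bool (L = L2) * \<nu> L v))"
    (is "is_unit_flow _ _ _ _ (extend_flow H ?b)")
proof -
  let ?F = "extend_flow H ?b"
  have b0: "?b L v = 0" if "\<not> (L \<in> Lsets R m \<and> v \<in> L)" for L v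
    using that supp L by auto
  have H0: "H x y = 0" if "\<not> adj R m x y" for x y using H(2) that by blast
  have anti: "is_antisym_fun (tedges R m) ?F"
    unfolding is_antisym_fun_def
  proof (intro conjI allI impI)
    show "?F x y = - ?F y x" for x y
      by (cases x; cases y) (auto simp: extend_flow_def split: prod.splits intro: H(1))
    show "?F x y = 0" if "\<not> uedge (tedges R m) x y" for x y
    proof (cases x)
      case (Inl u)
      show ?thesis
      proof (cases y)
        case (Inl v)
        then show ?thesis using \<open>x = Inl u\<close> that H0 by (simp add: extend_flow_def uedge_tedges_Inl_Inl)
      next
        case (Inr z)
        obtain L v where z: "z = (L, v)" by (cases z)
        show ?thesis using \<open>x = Inl u\<close> Inr z that b0[of L v]
          by (auto simp: extend_flow_def uedge_tedges_Inl_Inr)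
      qed
    next
      case (Inr z)
      obtain L v where z: "z = (L, v)" by (cases z)
      show ?thesis using Inr z that b0[of L v]
        by (cases y) (auto simp: extend_flow_def uedge_tedges_Inr_Inl)
    qed
  qed
  have div_new: "flow_div (tedges R m) ?F (Inr (L, v)) = ?b L v" if "L \<in> Lsets R m" "v \<in> L" for L v
  proof -
    have "{y. uedge (tedges R m) (Inr (L, v)) y} = {Inl v}"
    proof (intro equalityI subsetI)
      fix y assume "y \<in> {y. uedge (tedges R m) (Inr (L, v)) y}"
      then show "y \<in> {Inl v}"
        by (cases y) (auto simp: uedge_tedges_Inr_Inl uedge_tedges_Inr_Inr)
    qed (use that in \<open>auto simp: uedge_tedges_Inr_Inl\<close>)
    then show ?thesis by (simp add: flow_div_def extend_flow_def)
  qed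
  have div_old: "flow_div (tedges R m) ?F (Inl v) = 0" if v: "v \<in> words R m" for v
  proof -
    have eq: "{y. uedge (tedges R m) (Inl v) y}
        = Inl ` {u. adj R m v u} \<union> (\<lambda>L. Inr (L, v)) ` {L \<in> Lsets R m. v \<in> L}"
    proof (intro equalityI subsetI)
      fix y assume "y \<in> {y. uedge (tedges R m) (Inl v) y}"
      then show "y \<in> Inl ` {u. adj R m v u} \<union> (\<lambda>L. Inr (L, v)) ` {L \<in> Lsets R m. v \<in> L}"
        by (cases y) (auto simp: uedge_tedges_Inl_Inr uedge_tedges_Inl_Inl)
    qed (auto simp: uedge_tedges_Inl_Inr uedge_tedges_Inl_Inl)
    have sub: "{u. adj R m v u} \<subseteq> words R m" using adj_words by blast
    then have fin: "finite {u. adj R m v u}" using finite_words finite_subset by blast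
    have "flow_div (tedges R m) ?F (Inl v)
        = (\<Sum>y\<in>Inl ` {u. adj R m v u}. ?F (Inl v) y)
          + (\<Sum>y\<in>(\<lambda>L. Inr (L, v)) ` {L \<in> Lsets R m. v \<in> L}. ?F (Inl v) y)"
      unfolding flow_div_def eq using fin finite_Lsets by (intro sum.union_disjoint) auto
    also have "(\<Sum>y\<in>Inl ` {u. adj R m v u}. ?F (Inl v) y) = (\<Sum>u\<in>{u. adj R m v u}. H v u)"
      by (subst sum.reindex) (auto simp: extend_flow_def)
    also have "\<dots> = (\<Sum>u\<in>words R m. H v u)"
      using sub finite_words H0 by (intro sum.mono_neutral_left) auto
    also have "\<dots> = \<nu> L1 v - \<nu> L2 v" using H(3)[OF v] .
    also have "(\<Sum>y\<in>(\<lambda>L. Inr (L, v)) ` {L \<in> Lsets R m. v \<in> L}. ?F (Inl v) y)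
        = (\<Sum>L\<in>{L \<in> Lsets R m. v \<in> L}. - ?b L v)"
      by (subst sum.reindex) (auto simp: extend_flow_def inj_on_def)
    \<comment> \<open>\<open>\<nu> L\<close> vanishes off L, so gates not containing v may be added.
      A word may lie in several gates; then several new edges meet at it.\<close>
    also have "\<dots> = (\<Sum>L\<in>Lsets R m. - ?b L v)"
      using finite_Lsets supp by (intro sum.mono_neutral_left) auto
    also have "\<dots> = - (\<nu> L1 v - \<nu> L2 v)"
    proof -
      have "(\<Sum>L\<in>Lsets R m. of_bool (L = L') * \<nu> L v) = \<nu> L' v" if "L' \<in> Lsets R m" for L'
        using finite_Lsets that by (subst sum.mono_neutral_right[of _ "{L'}"]) auto
      then show ?thesis using L by (simp add: sum_negf sum_subtractf)
    qed
    finally show ?thesis by simp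
  qed
  have "(\<Sum>x\<in>tilde L1. flow_div (tedges R m) ?F x) = (\<Sum>v\<in>L1. flow_div (tedges R m) ?F (Inr (L1, v)))"
  proof -
    have "tilde L1 = (\<lambda>v. Inr (L1, v)) ` L1" by (auto simp: tilde_def)
    then show ?thesis by (simp add: sum.reindex inj_on_def)
  qed
  also have "\<dots> = (\<Sum>v\<in>L1. \<nu> L1 v)" using div_new L by (intro sum.cong) auto
  also have "\<dots> = (\<Sum>v\<in>words R m. \<nu> L1 v)"
    using finite_words Lsets_subset_words L supp by (intro sum.mono_neutral_left) auto
  finally have unit: "(\<Sum>x\<in>tilde L1. flow_div (tedges R m) ?F x) = 1" using one by simp
  have "flow_div (tedges R m) ?F x = 0" if x: "x \<in> tverts R m" "x \<notin> tilde L1 \<union> tilde L2" for x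
  proof -
    from x(1) consider v where "x = Inl v" "v \<in> words R m" | L v where "x = Inr (L, v)" "L \<in> Lsets R m" "v \<in> L"
      by (auto simp: tverts_def)
    then show ?thesis
    proof cases
      case 2
      then have "L \<noteq> L1" "L \<noteq> L2" using x(2) by (auto simp: tilde_def)
      then show ?thesis using div_new 2 by simp
    qed (simp add: div_old)
  qed
  moreover have "tilde L1 \<subseteq> tverts R m" "tilde L2 \<subseteq> tverts R m" "tilde L1 \<noteq> {}" "tilde L2 \<noteq> {}"
    "tilde L1 \<inter> tilde L2 = {}"
    using L Lsets_subset_words by (auto simp: tilde_def tverts_def)
  ultimately show ?thesis
    unfolding is_unit_flow_def is_flow_def using anti unit by blast
qed

lemma extend_flow_energy:
  assumes L: "L1 \<in> Lsets R m" "L2 \<in> Lsets R m" "L1 \<noteq> L2"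
  shows "flow_energy q (tedges R m)
      (extend_flow H (\<lambda>L v. of_bool (L = L1) * \<nu> L v - of_bool (L = L2) * \<nu> L v))
    \<le> (\<Sum>x\<in>words R m. \<Sum>y\<in>words R m. \<bar>H x y\<bar> powr q)
      + (\<Sum>x\<in>words R m. \<bar>\<nu> L1 x\<bar> powr q) + (\<Sum>x\<in>words R m. \<bar>\<nu> L2 x\<bar> powr q)"
    (is "flow_energy q _ (extend_flow H ?b) \<le> _")
proof -
  let ?F = "extend_flow H ?b"
  have eq: "tedges R m = map_prod Inl Inl ` edges R m \<union> (\<lambda>(L, v). (Inr (L, v), Inl v)) ` (SIGMA L:Lsets R m. L)"
    by (auto simp: tedges_def map_prod_def image_iff)
  have finE: "finite (edges R m)"
    using edges_subset finite_words by (meson finite_SigmaI finite_subset)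
  have finL: "finite L" if "L \<in> Lsets R m" for L
    using that Lsets_subset_words finite_words finite_subset by blast
  have "flow_energy q (tedges R m) ?F
      = (\<Sum>(x, y)\<in>map_prod Inl Inl ` edges R m. \<bar>?F x y\<bar> powr q)
        + (\<Sum>(x, y)\<in>(\<lambda>(L, v). (Inr (L, v), Inl v)) ` (SIGMA L:Lsets R m. L). \<bar>?F x y\<bar> powr q)"
    unfolding flow_energy_def eq using finE finL finite_Lsets
    by (intro sum.union_disjoint finite_imageI finite_SigmaI) auto
  also have "(\<Sum>(x, y)\<in>map_prod Inl Inl ` edges R m. \<bar>?F x y\<bar> powr q) = flow_energy q (edges R m) H"
    unfolding flow_energy_def
    by (subst sum.reindex) (auto simp: inj_on_def extend_flow_def intro!: sum.cong)
  also have "(\<Sum>(x, y)\<in>(\<lambda>(L, v). (Inr (L, v), Inl v)) ` (SIGMA L:Lsets R m. L). \<bar>?F x y\<bar> powr q)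
      = (\<Sum>(L, v)\<in>(SIGMA L:Lsets R m. L). \<bar>?b L v\<bar> powr q)"
    by (subst sum.reindex) (auto simp: inj_on_def extend_flow_def intro!: sum.cong)
  also have "\<dots> = (\<Sum>L\<in>Lsets R m. \<Sum>v\<in>L. \<bar>?b L v\<bar> powr q)"
    using finite_Lsets finL by (subst sum.Sigma) auto
  also have "\<dots> \<le> (\<Sum>L\<in>Lsets R m. \<Sum>v\<in>words R m. \<bar>?b L v\<bar> powr q)"
    using Lsets_subset_words finite_words by (intro sum_mono sum_mono2) auto
  also have "\<dots> = (\<Sum>L\<in>{L1, L2}. \<Sum>v\<in>words R m. \<bar>?b L v\<bar> powr q)"
    using finite_Lsets L by (intro sum.mono_neutral_right) auto
  also have "\<dots> = (\<Sum>x\<in>words R m. \<bar>\<nu> L1 x\<bar> powr q) + (\<Sum>x\<in>words R m. \<bar>\<nu> L2 x\<bar> powr q)"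
    using L by simp
  finally show ?thesis using flow_energy_le_sum[of q m H] by simp
qed

end

lemma eff_energy_le:
  fixes F :: "'a \<Rightarrow> 'a \<Rightarrow> real"
  assumes "is_unit_flow V E A B F"
  shows "eff_energy q V E A B \<le> flow_energy q E F"
  unfolding eff_energy_def
proof (rule cInf_lower)
  have "0 \<le> flow_energy q E F" for F :: "'a \<Rightarrow> 'a \<Rightarrow> real"
    unfolding flow_energy_def by (intro sum_nonneg) auto
  then show "bdd_below (flow_energy q E ` {F. is_unit_flow V E A B F})"
    by (intro bdd_belowI2)
qed (use assms in blast)

context flip_symmetric_igs
begin

text \<open>Every \<open>\<nu> L\<close> is within cost \<open>N * c\<close> of
  \<open>\<alpha>\<close>, with N the order of the flip group. A flow between two gates passes
  through \<open>\<alpha>\<close> and costs \<open>2 powr q * (N * c + N * c)\<close>; the new edges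
  at its two gates add \<open>N * c\<close> each.\<close>

lemma flow_basis_exists:
  assumes "0 < q"
    and orbit: "\<And>L. L \<in> Lsets R m \<Longrightarrow> \<exists>g\<in>flip_group R. map g ` L0 = L"
    and supp: "\<And>x. x \<notin> L0 \<Longrightarrow> \<alpha> x = 0"
    and one: "(\<Sum>x\<in>words R m. \<alpha> x) = 1"
    and bd: "(\<Sum>x\<in>words R m. \<bar>\<alpha> x\<bar> powr q) \<le> c"
    and shift: "\<And>g. g \<in> flip_group R \<Longrightarrow>
      transports q (words R m) (adj R m) c \<alpha> (push (words R m) (map g) \<alpha>)"
  obtains FB where "is_flow_basis R m FB"
    "\<And>L1 L2. L1 \<in> Lsets R m \<Longrightarrow> L2 \<in> Lsets R m \<Longrightarrow> L1 \<noteq> L2 \<Longrightarrow>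
      flow_energy q (tedges R m) (FB L1 L2) \<le> (2 powr q + 1) * (2 * card (flip_group R)) * c"
proof -
  let ?W = "words R m"
  have c: "0 \<le> c" using bd by (rule order_trans[rotated]) (intro sum_nonneg powr_ge_zero)
  define G where "G L = {g \<in> flip_group R. map g ` L0 = L}" for L
  define N where "N = real (card (flip_group R))"
  have finG: "finite (G L)" for L using finite_flip_group by (simp add: G_def)
  have cardG: "real (card (G L)) \<le> N" for L
    unfolding G_def N_def using finite_flip_group by (intro of_nat_mono card_mono) auto
  have GL: "G L \<noteq> {}" if "L \<in> Lsets R m" for L using orbit[OF that] by (auto simp: G_def)
  \<comment> \<open>Averaging over all g that carry L0 to L, instead of choosing one, removes the
    ambiguity left by the stabiliser of L0.\<close>
  define \<nu> where "\<nu> L x = (\<Sum>g\<in>G L. push ?W (map g) \<alpha> x) / card (G L)" for L x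
  have bij: "bij_betw (map g) ?W ?W" if "g \<in> flip_group R" for g
    using that flip_group_automorphism automorphism_words by blast
  have \<nu>_supp: "\<nu> L x = 0" if "x \<notin> L" for L x
  proof -
    have "push ?W (map g) \<alpha> x = 0" if "g \<in> G L" for g
      unfolding push_def using that \<open>x \<notin> L\<close> supp by (intro sum.neutral) (auto simp: G_def)
    then show ?thesis by (simp add: \<nu>_def)
  qed
  have \<nu>_one: "(\<Sum>x\<in>?W. \<nu> L x) = 1" if "L \<in> Lsets R m" for L
  proof -
    have "(\<Sum>x\<in>?W. \<nu> L x) = (\<Sum>g\<in>G L. \<Sum>x\<in>?W. push ?W (map g) \<alpha> x) / card (G L)"
      unfolding \<nu>_def sum_divide_distrib[symmetric] by (subst sum.swap) simp
    also have "(\<Sum>g\<in>G L. \<Sum>x\<in>?W. push ?W (map g) \<alpha> x) = (\<Sum>g\<in>G L. 1)"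
      using bij one finite_words
      by (intro sum.cong refl) (simp add: sum_push G_def bij_betw_def)
    finally show ?thesis using GL[OF that] finG by simp
  qed
  have \<nu>_bd: "(\<Sum>x\<in>?W. \<bar>\<nu> L x\<bar> powr q) \<le> N * c" if "L \<in> Lsets R m" for L
  proof -
    have "(\<Sum>x\<in>?W. \<bar>\<nu> L x\<bar> powr q) \<le> (\<Sum>x\<in>?W. \<Sum>g\<in>G L. \<bar>push ?W (map g) \<alpha> x\<bar> powr q)"
      unfolding \<nu>_def by (intro sum_mono abs_mean_powr_le finG GL[OF that] \<open>0 < q\<close>)
    also have "\<dots> = (\<Sum>g\<in>G L. \<Sum>x\<in>?W. \<bar>push ?W (map g) \<alpha> x\<bar> powr q)" by (rule sum.swap)
    also have "\<dots> \<le> (\<Sum>g\<in>G L. c)"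
    proof (intro sum_mono)
      fix g assume "g \<in> G L"
      then have b: "bij_betw (map g) ?W ?W" using bij by (simp add: G_def)
      have "(\<Sum>x\<in>?W. \<bar>push ?W (map g) \<alpha> x\<bar> powr q) = (\<Sum>x\<in>?W. \<bar>push ?W (map g) \<alpha> (map g x)\<bar> powr q)"
        by (rule sum.reindex_bij_betw[OF b, symmetric])
      also have "\<dots> = (\<Sum>x\<in>?W. \<bar>\<alpha> x\<bar> powr q)"
        using b by (intro sum.cong refl) (simp add: push_inj bij_betw_def)
      finally show "(\<Sum>x\<in>?W. \<bar>push ?W (map g) \<alpha> x\<bar> powr q) \<le> c" using bd by simp
    qed
    also have "\<dots> \<le> N * c" using cardG c by (simp add: mult_right_mono)
    finally show ?thesis .
  qed
  have \<nu>_tr: "transports q ?W (adj R m) (N * c) \<alpha> (\<nu> L)" if "L \<in> Lsets R m" for L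
  proof (rule transports_mono)
    show "transports q ?W (adj R m) (card (G L) * c) \<alpha> (\<nu> L)"
      unfolding \<nu>_def
      by (intro transports_mean finG GL[OF that] \<open>0 < q\<close> shift) (simp add: G_def)
    show "card (G L) * c \<le> N * c" using cardG c by (rule mult_right_mono)
  qed
  \<comment> \<open>Composition with \<open>flip R t\<close> maps \<open>G L\<close> bijectively
    onto the set belonging to the flipped gate, so the two averages correspond term by term.\<close>
  have \<nu>_flip: "\<nu> (map (flip R t) ` L) (map (flip R t) x) = \<nu> L x"
    if t: "t \<in> igsT R" for t L x
  proof -
    let ?h = "flip R t"
    have "inj ?h" using flip_automorphism[OF t] permutes_inj by (auto simp: automorphism_def)
    then have injm: "inj (map ?h)" by (rule inj_mapI)
    have inj: "inj_on (\<lambda>g. ?h \<circ> g) (G L)"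
      using \<open>inj ?h\<close> by (intro inj_onI ext) (metis comp_apply injD)
    have img: "G (map ?h ` L) = (\<lambda>g. ?h \<circ> g) ` G L"
    proof (intro equalityI subsetI)
      fix g assume g: "g \<in> G (map ?h ` L)"
      then have "g \<in> (\<lambda>g. ?h \<circ> g) ` flip_group R"
        using flip_comp_flip_group[OF t] by (simp add: G_def)
      then obtain g' where g': "g' \<in> flip_group R" "g = ?h \<circ> g'" by blast
      with g have "map ?h ` map g' ` L0 = map ?h ` L" by (simp add: G_def image_comp)
      then have "map g' ` L0 = L" using injm by (simp add: inj_image_eq_iff)
      then have "g' \<in> G L" using g' by (simp add: G_def)
      then show "g \<in> (\<lambda>g. ?h \<circ> g) ` G L" using g'(2) by blast
    next
      fix g assume "g \<in> (\<lambda>g. ?h \<circ> g) ` G L"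
      then obtain g' where g': "g' \<in> flip_group R" "map g' ` L0 = L" "g = ?h \<circ> g'"
        unfolding G_def by blast
      then have "map g ` L0 = map ?h ` L" by (simp add: image_comp flip: g'(2))
      then show "g \<in> G (map ?h ` L)" using flip_group.flip[OF t g'(1)] g'(3) unfolding G_def by blast
    qed
    have "push ?W (map (?h \<circ> g)) \<alpha> (map ?h x) = push ?W (map g) \<alpha> x" for g
    proof -
      have "{x' \<in> ?W. map (?h \<circ> g) x' = map ?h x} = {x' \<in> ?W. map g x' = x}"
        using injD[OF injm] by (auto simp flip: map_map)
      then show ?thesis by (simp add: push_def)
    qed
    then show ?thesis
      unfolding \<nu>_def img using inj by (simp add: sum.reindex card_image)
  qed
  have "\<forall>p\<in>Lsets R m \<times> Lsets R m. \<exists>H. (\<forall>x y. H x y = - H y x) \<and>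
      (\<forall>x y. H x y \<noteq> 0 \<longrightarrow> adj R m x y) \<and>
      (\<forall>x\<in>?W. (\<Sum>y\<in>?W. H x y) = \<nu> (fst p) x - \<nu> (snd p) x) \<and>
      (\<Sum>x\<in>?W. \<Sum>y\<in>?W. \<bar>H x y\<bar> powr q) \<le> 2 powr q * (N * c + N * c)"
  proof
    fix p assume "p \<in> Lsets R m \<times> Lsets R m"
    then have "fst p \<in> Lsets R m" "snd p \<in> Lsets R m" by auto
    from transports_trans[OF transports_sym[OF \<nu>_tr[OF this(1)]] \<nu>_tr[OF this(2)] \<open>0 < q\<close>]
    show "\<exists>H. (\<forall>x y. H x y = - H y x) \<and> (\<forall>x y. H x y \<noteq> 0 \<longrightarrow> adj R m x y) \<and>
      (\<forall>x\<in>?W. (\<Sum>y\<in>?W. H x y) = \<nu> (fst p) x - \<nu> (snd p) x) \<and>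
      (\<Sum>x\<in>?W. \<Sum>y\<in>?W. \<bar>H x y\<bar> powr q) \<le> 2 powr q * (N * c + N * c)"
      unfolding transports_def .
  qed
  from bchoice[OF this] obtain H where H: "\<forall>p\<in>Lsets R m \<times> Lsets R m. (\<forall>x y. H p x y = - H p y x) \<and>
      (\<forall>x y. H p x y \<noteq> 0 \<longrightarrow> adj R m x y) \<and>
      (\<forall>x\<in>?W. (\<Sum>y\<in>?W. H p x y) = \<nu> (fst p) x - \<nu> (snd p) x) \<and>
      (\<Sum>x\<in>?W. \<Sum>y\<in>?W. \<bar>H p x y\<bar> powr q) \<le> 2 powr q * (N * c + N * c)"
    by blast
  \<comment> \<open>The inner flows of different pairs are chosen independently, since (FB2) to
    (FB4) only constrain the new edges, where the values come from \<open>\<nu>\<close>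
    alone.\<close>
  define FB where "FB L1 L2 = extend_flow (H (L1, L2))
    (\<lambda>L v. of_bool (L = L1) * \<nu> L v - of_bool (L = L2) * \<nu> L v)" for L1 L2
  have out: "FB L1 L2 (Inr (L, v)) (Inl v) = of_bool (L = L1) * \<nu> L v - of_bool (L = L2) * \<nu> L v"
    and "in": "FB L1 L2 (Inl v) (Inr (L, v)) = - (of_bool (L = L1) * \<nu> L v - of_bool (L = L2) * \<nu> L v)"
    for L1 L2 L v by (simp_all add: FB_def extend_flow_def)
  have H': "H (L1, L2) x y = - H (L1, L2) y x" "H (L1, L2) x y \<noteq> 0 \<Longrightarrow> adj R m x y"
    "x \<in> ?W \<Longrightarrow> (\<Sum>y\<in>?W. H (L1, L2) x y) = \<nu> L1 x - \<nu> L2 x"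
    "(\<Sum>x\<in>?W. \<Sum>y\<in>?W. \<bar>H (L1, L2) x y\<bar> powr q) \<le> 2 powr q * (N * c + N * c)"
    if "L1 \<in> Lsets R m" "L2 \<in> Lsets R m" for L1 L2 x y
    using bspec[OF H, of "(L1, L2)"] that unfolding mem_Times_iff fst_conv snd_conv by blast+
  have fb4: "\<nu> (Ipow R m t s) v = \<nu> (Ipow R m t (\<not> s)) (flipw R t v)"
    if "t \<in> igsT R" "v \<in> Ipow R m t s" for t s v
  proof -
    have L: "Ipow R m t s \<subseteq> ?W" by (rule Ipow_subset_words[OF that(1)])
    have "map (flip R t) ` Ipow R m t s = Ipow R m t (\<not> s)"
      by (intro map_image_Ipow flip_gate that)
    moreover have "map (flip R t) v = flipw R t v" using L that by (intro map_flip) auto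
    ultimately show ?thesis using \<nu>_flip[OF that(1), of "Ipow R m t s" v] by simp
  qed
  have "is_flow_basis R m FB"
    unfolding is_flow_basis_def
  proof (intro conjI ballI impI allI)
    fix L1 L2 assume "L1 \<in> Lsets R m" "L2 \<in> Lsets R m" "L1 \<noteq> L2"
    then show "is_unit_flow (tverts R m) (tedges R m) (tilde L1) (tilde L2) (FB L1 L2)"
      unfolding FB_def
      by (intro extend_flow_unit_flow H' \<nu>_supp \<nu>_one)
  next
    fix t s assume t: "t \<in> igsT R" and ne: "Ipow R m t s \<noteq> Ipow R m t (\<not> s)"
    show "let L1 = Ipow R m t s; L2 = Ipow R m t (\<not> s) in
         \<forall>v\<in>L1. FB L1 L2 (Inr (L1, v)) (Inl v)
                  = FB L1 L2 (Inl (flipw R t v)) (Inr (L2, flipw R t v))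
               \<and> FB L1 L2 (Inr (L1, v)) (Inl v) = FB L2 L1 (Inl v) (Inr (L1, v))"
      using ne fb4[OF t] by (simp add: Let_def out "in")
  qed (simp_all add: out "in")
  moreover have "flow_energy q (tedges R m) (FB L1 L2) \<le> (2 powr q + 1) * (2 * card (flip_group R)) * c"
    if L: "L1 \<in> Lsets R m" "L2 \<in> Lsets R m" "L1 \<noteq> L2" for L1 L2
  proof -
    have "flow_energy q (tedges R m) (FB L1 L2) \<le> (\<Sum>x\<in>?W. \<Sum>y\<in>?W. \<bar>H (L1, L2) x y\<bar> powr q)
        + (\<Sum>x\<in>?W. \<bar>\<nu> L1 x\<bar> powr q) + (\<Sum>x\<in>?W. \<bar>\<nu> L2 x\<bar> powr q)"
      unfolding FB_def by (rule extend_flow_energy[OF L])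
    also have "\<dots> \<le> 2 powr q * (N * c + N * c) + N * c + N * c"
      by (intro add_mono H'(4) \<nu>_bd L)
    also have "\<dots> = (2 powr q + 1) * (2 * card (flip_group R)) * c"
      by (simp add: N_def algebra_simps)
    finally show ?thesis .
  qed
  ultimately show thesis by (rule that)
qed

section \<open>Distributions that can be moved along a symmetry\<close>

definition gate_transport ::
    "real \<Rightarrow> 't \<Rightarrow> nat \<Rightarrow> real \<Rightarrow> ('a list \<Rightarrow> real) \<Rightarrow> ('a list \<Rightarrow> real) \<Rightarrow> bool" where
  "gate_transport q t m e \<alpha> \<beta> \<longleftrightarrow> (\<forall>x. x \<notin> Ipow R m t False \<longrightarrow> \<alpha> x = 0) \<and>
     (\<forall>x. x \<notin> Ipow R m t True \<longrightarrow> \<beta> x = 0) \<and> transports q (words R m) (adj R m) e \<alpha> \<beta>"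

text \<open>The constant is chosen before m and before the flow; this order makes the final constant
  uniform.\<close>

definition shiftable :: "real \<Rightarrow> 't \<Rightarrow> ('a \<Rightarrow> 'a) \<Rightarrow> bool" where
  "shiftable q t g \<longleftrightarrow> (\<exists>c. \<forall>m e \<alpha> \<beta>. gate_transport q t m e \<alpha> \<beta> \<longrightarrow>
     transports q (words R m) (adj R m) (c * e) \<alpha> (push (words R m) (map g) \<alpha>))"

lemma shiftable_id: "shiftable q t id"
  unfolding shiftable_def
proof (intro exI[of _ 0] allI impI)
  fix m e \<alpha>
  have "push (words R m) (map id) \<alpha> x = \<alpha> x" if "x \<in> words R m" for x
    using that finite_words by (intro push_id_on) auto
  then have "transports q (words R m) (adj R m) 0 \<alpha> (push (words R m) (map id) \<alpha>)
      \<longleftrightarrow> transports q (words R m) (adj R m) 0 \<alpha> \<alpha>"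
    by (intro transports_cong) auto
  then show "transports q (words R m) (adj R m) (0 * e) \<alpha> (push (words R m) (map id) \<alpha>)"
    using transports_refl by (simp del: list.map_id list.map_id0)
qed

text \<open>Applying g to a transport from \<open>\<alpha>\<close> to \<open>h \<alpha>\<close>
  gives one from \<open>g \<alpha>\<close> to \<open>g h \<alpha>\<close>, which is appended to the
  one from \<open>\<alpha>\<close> to \<open>g \<alpha>\<close>.\<close>

lemma shiftable_comp:
  assumes "shiftable q t g" "shiftable q t h" "automorphism R g" "automorphism R h" "0 < q"
  shows "shiftable q t (g \<circ> h)"
proof -
  from assms(1) obtain c where c: "\<And>m \<alpha> \<beta> e. gate_transport q t m e \<alpha> \<beta> \<Longrightarrow>
     transports q (words R m) (adj R m) (c * e) \<alpha> (push (words R m) (map g) \<alpha>)"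
    unfolding shiftable_def by blast
  from assms(2) obtain d where d: "\<And>m \<alpha> \<beta> e. gate_transport q t m e \<alpha> \<beta> \<Longrightarrow>
     transports q (words R m) (adj R m) (d * e) \<alpha> (push (words R m) (map h) \<alpha>)"
    unfolding shiftable_def by blast
  show ?thesis
    unfolding shiftable_def
  proof (intro exI[of _ "2 powr q * (c + 4 powr q * d)"] allI impI)
    fix m e \<alpha> \<beta>
    assume a: "gate_transport q t m e \<alpha> \<beta>"
    have "map h ` words R m \<subseteq> words R m"
      using automorphism_words[OF assms(4)] by (simp add: bij_betw_def)
    then have eq: "push (words R m) (map (g \<circ> h)) \<alpha>
        = push (words R m) (map g) (push (words R m) (map h) \<alpha>)"
      using push_comp[OF finite_words, of "map h" m "map g" \<alpha>] by (simp add: comp_def)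
    have "transports q (words R m) (adj R m) (2 powr q * (c * e + 4 powr q * (d * e))) \<alpha>
        (push (words R m) (map (g \<circ> h)) \<alpha>)"
      unfolding eq
      by (rule transports_trans[OF c[OF a] transports_automorphism[OF d[OF a] assms(5,3)] assms(5)])
    then show "transports q (words R m) (adj R m) (2 powr q * (c + 4 powr q * d) * e) \<alpha>
        (push (words R m) (map (g \<circ> h)) \<alpha>)"
      by (simp add: algebra_simps)
  qed
qed

lemma shiftable_flip_group:
  assumes "\<And>t'. t' \<in> igsT R \<Longrightarrow> shiftable q t (flip R t')" "0 < q" "g \<in> flip_group R"
  shows "shiftable q t g"
  using assms(3)
proof (induction rule: flip_group.induct)
  case id
  show ?case by (rule shiftable_id)
next
  case (flip t' g)
  then show ?case
    by (intro shiftable_comp assms(1,2) flip_automorphism flip_group_automorphism)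
qed

section \<open>Effective energies between opposite gates\<close>

lemma unit_flow_exists:
  assumes "t \<in> igsT R" "1 \<le> m"
  shows "\<exists>F. is_unit_flow (words R m) (edges R m) (Ipow R m t False) (Ipow R m t True) F"
proof -
  note sub = Ipow_subset_words[OF assms(1), of m]
  obtain x y where xy: "x \<in> Ipow R m t False" "y \<in> Ipow R m t True"
    using Ipow_nonempty[OF assms(1)] by blast
  then have "x \<in> words R m" "y \<in> words R m" using sub by blast+
  \<comment> \<open>Being a unit flow does not involve the exponent, so any positive one serves
    here.\<close>
  then obtain c where "transports 1 (words R m) (adj R m) c (\<lambda>z. of_bool (z = x)) (\<lambda>z. of_bool (z = y))"
    using dirac_transports[of x m y 1] by auto
  then obtain F where "is_unit_flow (words R m) (edges R m) (Ipow R m t False) (Ipow R m t True) F"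
  proof (rule transports_unit_flow[OF _ sub sub Ipow_nonempty[OF assms(1)] Ipow_nonempty[OF assms(1)]
        Ipow_disjoint[OF assms]])
    show "(\<Sum>z\<in>words R m. of_bool (z = x) :: real) = 1"
      using \<open>x \<in> words R m\<close> finite_words by (simp add: of_bool_def)
  qed (use xy that in auto)
  then show ?thesis by blast
qed

text \<open>Unit flows are transported by g. The factor is what the generic push estimate and the
  double count of edges lose; it ends up in the final constant.\<close>

lemma eff_energy_automorphism_le:
  assumes g: "automorphism R g" "g ` Ipm R t False = Ipm R t0 False" "g ` Ipm R t True = Ipm R t0 True"
    and t: "t \<in> igsT R" "t0 \<in> igsT R" and "1 \<le> m" "0 < q"
  shows "eff_energy q (words R m) (edges R m) (Ipow R m t0 False) (Ipow R m t0 True)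
    \<le> 4 powr q * 2 * eff_energy q (words R m) (edges R m) (Ipow R m t False) (Ipow R m t True)"
    (is "?e0 \<le> _")
proof -
  let ?W = "words R m"
  have "?e0 / (4 powr q * 2) \<le> eff_energy q ?W (edges R m) (Ipow R m t False) (Ipow R m t True)"
    unfolding eff_energy_def[of _ _ _ "Ipow R m t False"]
  proof (rule cInf_greatest)
    show "flow_energy q (edges R m) ` {F. is_unit_flow ?W (edges R m) (Ipow R m t False) (Ipow R m t True) F} \<noteq> {}"
      using unit_flow_exists[OF t(1) \<open>1 \<le> m\<close>] by blast
    fix e assume "e \<in> flow_energy q (edges R m) `
      {F. is_unit_flow ?W (edges R m) (Ipow R m t False) (Ipow R m t True) F}"
    then obtain F where F: "is_unit_flow ?W (edges R m) (Ipow R m t False) (Ipow R m t True) F"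
      and e: "e = flow_energy q (edges R m) F" by blast
    obtain \<alpha> \<beta> where
      a: "\<forall>x. x \<notin> Ipow R m t False \<longrightarrow> \<alpha> x = 0" "\<forall>x. x \<notin> Ipow R m t True \<longrightarrow> \<beta> x = 0"
      "(\<Sum>x\<in>?W. \<alpha> x) = 1" "transports q ?W (adj R m) (2 * e) \<alpha> \<beta>"
      unfolding e by (rule unit_flow_transports[OF F, of q])
    have img: "map g ` Ipow R m t False = Ipow R m t0 False" "map g ` Ipow R m t True = Ipow R m t0 True"
      using g by (auto intro!: map_image_Ipow)
    have push0: "push ?W (map g) \<gamma> x = 0" if "x \<notin> map g ` A" "\<And>x. x \<notin> A \<Longrightarrow> \<gamma> x = 0" for x A \<gamma>
      unfolding push_def using that by (intro sum.neutral) blast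
    have "map g ` ?W \<subseteq> ?W" using automorphism_words[OF g(1)] by (simp add: bij_betw_def)
    then have one: "(\<Sum>x\<in>?W. push ?W (map g) \<alpha> x) = 1"
      using a(3) finite_words by (simp add: sum_push)
    obtain F' where F': "is_unit_flow ?W (edges R m) (Ipow R m t0 False) (Ipow R m t0 True) F'"
      "flow_energy q (edges R m) F' \<le> 4 powr q * (2 * e)"
    proof (rule transports_unit_flow[OF transports_automorphism[OF a(4) \<open>0 < q\<close> g(1)]
          Ipow_subset_words[OF t(2)] Ipow_subset_words[OF t(2)]
          Ipow_nonempty[OF t(2)] Ipow_nonempty[OF t(2)] Ipow_disjoint[OF t(2) \<open>1 \<le> m\<close>] _ _ one])
      show "push ?W (map g) \<alpha> x = 0" if "x \<notin> Ipow R m t0 False" for x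
        using push0[of x "Ipow R m t False" \<alpha>] that a(1) unfolding img by simp
      show "push ?W (map g) \<beta> x = 0" if "x \<notin> Ipow R m t0 True" for x
        using push0[of x "Ipow R m t True" \<beta>] that a(2) unfolding img by simp
    qed (rule that)
    then show "?e0 / (4 powr q * 2) \<le> e"
      using eff_energy_le[OF F'(1), of q] by (simp add: divide_le_eq mult_ac)
  qed
  then show ?thesis by (simp add: divide_le_eq mult_ac)
qed

text \<open>A total mass of 1 has to leave finitely many vertices through boundedly many edges each.
  The lower bound degenerates with m, but positivity alone ensures that a flow of energy below twice
  the infimum exists, so no minimiser is required.\<close>

lemma eff_energy_pos:
  assumes t: "t \<in> igsT R" and "1 \<le> m" "0 < q"
  shows "0 < eff_energy q (words R m) (edges R m) (Ipow R m t False) (Ipow R m t True)"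
proof -
  let ?W = "words R m"
  define K where "K = real (card ?W) powr q * (real (card (letter_darts R)) powr q * 2)"
  have le: "1 \<le> K * flow_energy q (edges R m) F"
    if F: "is_unit_flow ?W (edges R m) (Ipow R m t False) (Ipow R m t True) F" for F
  proof -
    obtain \<alpha> \<beta> where
      a: "\<forall>x. x \<notin> Ipow R m t False \<longrightarrow> \<alpha> x = 0" "\<forall>x. x \<notin> Ipow R m t True \<longrightarrow> \<beta> x = 0"
      "(\<Sum>x\<in>?W. \<alpha> x) = 1" "transports q ?W (adj R m) (2 * flow_energy q (edges R m) F) \<alpha> \<beta>"
      by (rule unit_flow_transports[OF F, of q])
    have "\<alpha> x = 0 \<or> \<beta> x = 0" for x
      using a(1,2) Ipow_disjoint[OF t \<open>1 \<le> m\<close>] by blast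
    note src = source_powr_le[OF a(4) \<open>0 < q\<close> this]
    have "1 = \<bar>\<Sum>x\<in>?W. \<alpha> x\<bar> powr q" using a(3) by simp
    also have "\<dots> \<le> real (card ?W) powr q * (\<Sum>x\<in>?W. \<bar>\<alpha> x\<bar> powr q)"
      by (rule abs_sum_powr_le[OF finite_words order_refl \<open>0 < q\<close>])
    also have "\<dots> \<le> real (card ?W) powr q * (real (card (letter_darts R)) powr q * (2 * flow_energy q (edges R m) F))"
      using src by (intro mult_left_mono) auto
    finally show ?thesis by (simp add: K_def mult_ac)
  qed
  obtain F where F: "is_unit_flow ?W (edges R m) (Ipow R m t False) (Ipow R m t True) F"
    using unit_flow_exists[OF t \<open>1 \<le> m\<close>] ..
  have "0 \<le> K" by (simp add: K_def)
  moreover have "K \<noteq> 0" using le[OF F] by auto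
  ultimately have K: "0 < K" by simp
  have "1 / K \<le> eff_energy q ?W (edges R m) (Ipow R m t False) (Ipow R m t True)"
    unfolding eff_energy_def
  proof (rule cInf_greatest)
    show "flow_energy q (edges R m) ` {F. is_unit_flow ?W (edges R m) (Ipow R m t False) (Ipow R m t True) F} \<noteq> {}"
      using F by blast
  qed (use le K in \<open>auto simp: divide_le_eq mult.commute\<close>)
  moreover have "0 < 1 / K" using K by simp
  ultimately show ?thesis by linarith
qed

text \<open>\<open>sym\<close> makes the energies of all types comparable, so a single type t0 need
  be analysed; \<open>orbit\<close> guarantees that the average defining the mass of each gate runs
  over a nonempty set.\<close>

theorem flow_bases_bounded:
  assumes "0 < q" and t0: "t0 \<in> igsT R"
    and orbit: "\<And>t s. t \<in> igsT R \<Longrightarrow> \<exists>g\<in>flip_group R. g ` Ipm R t0 False = Ipm R t s"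
    and shift: "\<And>t. t \<in> igsT R \<Longrightarrow> shiftable q t0 (flip R t)"
    and sym: "\<And>t. t \<in> igsT R \<Longrightarrow>
      \<exists>g. automorphism R g \<and> g ` Ipm R t False = Ipm R t0 False \<and> g ` Ipm R t True = Ipm R t0 True"
  shows "\<exists>C > 0. \<forall>m \<ge> 1. \<exists>FB. is_flow_basis R m FB \<and>
           (\<forall>t \<in> igsT R. fb_energy q R m FB
              \<le> C * eff_energy q (words R m) (edges R m) (Ipow R m t False) (Ipow R m t True))"
proof -
  let ?S = "\<lambda>c g. \<forall>m e \<alpha> \<beta>. gate_transport q t0 m e \<alpha> \<beta> \<longrightarrow>
     transports q (words R m) (adj R m) (c * e) \<alpha> (push (words R m) (map g) \<alpha>)"
  have "\<forall>g\<in>flip_group R. \<exists>c. ?S c g"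
    using shiftable_flip_group[OF shift \<open>0 < q\<close>] unfolding shiftable_def by blast
  from bchoice[OF this] obtain c where c: "\<forall>g\<in>flip_group R. ?S (c g) g" ..
  \<comment> \<open>\<open>D\<close> dominates the constant of \<open>source_powr_le\<close> and
    every \<open>c g\<close> at once. The \<open>c g\<close> come without a sign, hence the absolute
    values; the 1 makes \<open>D\<close> positive.\<close>
  define D where "D = real (card (letter_darts R)) powr q + (\<Sum>g\<in>flip_group R. \<bar>c g\<bar>) + 1"
  have cD: "c g \<le> D" if "g \<in> flip_group R" for g
  proof -
    have "\<bar>c g\<bar> \<le> (\<Sum>g\<in>flip_group R. \<bar>c g\<bar>)"
      using finite_flip_group that by (intro member_le_sum) auto
    then show ?thesis unfolding D_def using powr_ge_zero[of "real (card (letter_darts R))" q] by linarith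
  qed
  have D: "0 < D" "real (card (letter_darts R)) powr q \<le> D"
    unfolding D_def by (auto intro!: add_nonneg_pos sum_nonneg)
  define K where "K = (2 powr q + 1) * (2 * card (flip_group R))"
  have "card (flip_group R) > 0" using finite_flip_group flip_group.id by (auto simp: card_gt_0_iff)
  then have K: "0 < K" by (auto simp: K_def intro!: mult_pos_pos add_pos_pos)
  let ?e = "\<lambda>m t. eff_energy q (words R m) (edges R m) (Ipow R m t False) (Ipow R m t True)"
  have "\<exists>FB. is_flow_basis R m FB \<and> (\<forall>t\<in>igsT R. fb_energy q R m FB \<le> K * (D * 4) * (4 powr q * 2) * ?e m t)"
    if m: "1 \<le> m" for m
  proof -
    let ?W = "words R m"
    have pos: "0 < ?e m t0" by (rule eff_energy_pos[OF t0 m \<open>0 < q\<close>])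
    then have "?e m t0 < 2 * ?e m t0" by simp
    moreover have "flow_energy q (edges R m) ` {F. is_unit_flow ?W (edges R m) (Ipow R m t0 False) (Ipow R m t0 True) F} \<noteq> {}"
      using unit_flow_exists[OF t0 m] by blast
    ultimately obtain F where F: "is_unit_flow ?W (edges R m) (Ipow R m t0 False) (Ipow R m t0 True) F"
      and lt: "flow_energy q (edges R m) F < 2 * ?e m t0"
      using cInf_lessD[of "flow_energy q (edges R m) ` {F. is_unit_flow ?W (edges R m) (Ipow R m t0 False) (Ipow R m t0 True) F}"
          "2 * ?e m t0"]
      unfolding eff_energy_def by blast
    obtain \<alpha> \<beta> where
      a: "\<forall>x. x \<notin> Ipow R m t0 False \<longrightarrow> \<alpha> x = 0" "\<forall>x. x \<notin> Ipow R m t0 True \<longrightarrow> \<beta> x = 0"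
      "(\<Sum>x\<in>?W. \<alpha> x) = 1" and tr0: "transports q ?W (adj R m) (2 * flow_energy q (edges R m) F) \<alpha> \<beta>"
      by (rule unit_flow_transports[OF F, of q])
    \<comment> \<open>One factor 2 for near optimality, one for counting each edge twice.\<close>
    define e where "e = 4 * ?e m t0"
    have tr: "transports q ?W (adj R m) e \<alpha> \<beta>"
      using tr0 by (rule transports_mono) (use lt in \<open>simp add: e_def\<close>)
    have e: "0 \<le> e" using pos by (simp add: e_def)
    have "\<alpha> x = 0 \<or> \<beta> x = 0" for x
      using a(1,2) Ipow_disjoint[OF t0 m] by blast
    note src = source_powr_le[OF tr \<open>0 < q\<close> this]
    obtain FB where FB: "is_flow_basis R m FB"
      "\<And>L1 L2. L1 \<in> Lsets R m \<Longrightarrow> L2 \<in> Lsets R m \<Longrightarrow> L1 \<noteq> L2 \<Longrightarrow>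
        flow_energy q (tedges R m) (FB L1 L2) \<le> K * (D * e)"
    proof (rule flow_basis_exists[OF \<open>0 < q\<close>, of m "Ipow R m t0 False" \<alpha> "D * e"])
      show "\<exists>g\<in>flip_group R. map g ` Ipow R m t0 False = L" if "L \<in> Lsets R m" for L
      proof -
        from that obtain t s where "t \<in> igsT R" and L: "L = Ipow R m t s" by (auto simp: Lsets_def)
        then obtain g where "g \<in> flip_group R" "g ` Ipm R t0 False = Ipm R t s" using orbit by blast
        then show ?thesis using map_image_Ipow[of g R t0 False t s m] L by blast
      qed
      show "(\<Sum>x\<in>?W. \<bar>\<alpha> x\<bar> powr q) \<le> D * e"
        using src D e by (meson mult_right_mono order_trans)
      show "transports q ?W (adj R m) (D * e) \<alpha> (push ?W (map g) \<alpha>)" if "g \<in> flip_group R" for g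
      proof (rule transports_mono)
        show "transports q ?W (adj R m) (c g * e) \<alpha> (push ?W (map g) \<alpha>)"
          using bspec[OF c that] a(1,2) tr unfolding gate_transport_def by blast
        show "c g * e \<le> D * e" using cD[OF that] e by (rule mult_right_mono)
      qed
    qed (use a that in \<open>simp_all add: K_def\<close>)
    have "fb_energy q R m FB \<le> K * (D * e)"
      unfolding fb_energy_def
    proof (rule Max.boundedI)
      have "{flow_energy q (tedges R m) (FB L1 L2) | L1 L2. L1 \<in> Lsets R m \<and> L2 \<in> Lsets R m \<and> L1 \<noteq> L2}
          \<subseteq> (\<lambda>(L1, L2). flow_energy q (tedges R m) (FB L1 L2)) ` (Lsets R m \<times> Lsets R m)" by auto
      then show "finite {flow_energy q (tedges R m) (FB L1 L2) | L1 L2.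
          L1 \<in> Lsets R m \<and> L2 \<in> Lsets R m \<and> L1 \<noteq> L2}"
        using finite_Lsets by (meson finite_SigmaI finite_imageI finite_subset)
      have "Ipow R m t0 False \<in> Lsets R m" "Ipow R m t0 True \<in> Lsets R m"
        using t0 by (auto simp: Lsets_def)
      moreover have "Ipow R m t0 False \<noteq> Ipow R m t0 True"
        using Ipow_disjoint[OF t0 m] Ipow_nonempty[OF t0] by blast
      ultimately show "{flow_energy q (tedges R m) (FB L1 L2) | L1 L2.
          L1 \<in> Lsets R m \<and> L2 \<in> Lsets R m \<and> L1 \<noteq> L2} \<noteq> {}" by blast
    qed (use FB(2) in blast)
    moreover have "K * (D * e) \<le> K * (D * 4) * (4 powr q * 2) * ?e m t" if t: "t \<in> igsT R" for t
    proof -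
      obtain g where "automorphism R g" "g ` Ipm R t False = Ipm R t0 False" "g ` Ipm R t True = Ipm R t0 True"
        using sym[OF t] by blast
      then have "?e m t0 \<le> 4 powr q * 2 * ?e m t"
        by (rule eff_energy_automorphism_le[OF _ _ _ t t0 m \<open>0 < q\<close>])
      then have "K * (D * 4) * ?e m t0 \<le> K * (D * 4) * (4 powr q * 2 * ?e m t)"
        using K D by (intro mult_left_mono) auto
      then show ?thesis by (simp add: e_def mult_ac)
    qed
    ultimately show ?thesis using FB(1) by (meson order_trans)
  qed
  moreover have "0 < K * (D * 4) * (4 powr q * 2)" using K D by simp
  ultimately show ?thesis by blast
qed

end

section \<open>Folding along a reflection axis\<close>

text \<open>\<open>fold_side k N \<tau>\<close> folds \<open>W_m\<close> along the axis of a reflection \<open>\<tau>\<close> fixing the letter \<open>k\<close>: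
  the words whose first letter other than \<open>k\<close> lies in \<open>N\<close> form one of the two halves.\<close>

definition on_side :: "'a \<Rightarrow> 'a set \<Rightarrow> 'a list \<Rightarrow> bool" where
  "on_side k N w \<longleftrightarrow> dropWhile ((=) k) w \<noteq> [] \<and> hd (dropWhile ((=) k) w) \<in> N"

definition fold_side :: "'a \<Rightarrow> 'a set \<Rightarrow> ('a \<Rightarrow> 'a) \<Rightarrow> 'a list \<Rightarrow> 'a list" where
  "fold_side k N \<tau> w = (if on_side k N w then map \<tau> w else w)"

text \<open>Words consisting of k only lie on the axis and on neither side. The first other letter
  settles the side for good, and appending letters matches the recursion of
  \<open>darts\<close>.\<close>

lemma on_side_snoc:
  "on_side k N (w @ [a]) \<longleftrightarrow> (if set w \<subseteq> {k} then a \<noteq> k \<and> a \<in> N else on_side k N w)"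
proof (cases "set w \<subseteq> {k}")
  case True
  then have "dropWhile ((=) k) (w @ [a]) = dropWhile ((=) k) [a]"
    by (intro dropWhile_append2) auto
  then show ?thesis using True by (simp add: on_side_def)
next
  case False
  then obtain x where "x \<in> set w" "k \<noteq> x" by auto
  then have "dropWhile ((=) k) (w @ [a]) = dropWhile ((=) k) w @ [a]"
    and "dropWhile ((=) k) w \<noteq> []" by (simp_all add: dropWhile_append1 dropWhile_eq_Nil_conv) blast
  then show ?thesis using False by (simp add: on_side_def)
qed

lemma hd_dropWhile_in:
  assumes "dropWhile ((=) k) w \<noteq> []"
  shows "hd (dropWhile ((=) k) w) \<in> set w \<and> hd (dropWhile ((=) k) w) \<noteq> k"
  using hd_dropWhile[OF assms] set_dropWhileD[OF hd_in_set[OF assms]] by auto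

lemma on_side_letter: "on_side k N w \<Longrightarrow> \<exists>a\<in>set w. a \<noteq> k \<and> a \<in> N"
  unfolding on_side_def using hd_dropWhile_in[of k w] by (intro bexI[of _ "hd (dropWhile ((=) k) w)"]) auto

lemma on_side_cases:
  assumes "set w \<subseteq> insert k (N \<union> P)" "\<not> set w \<subseteq> {k}"
  shows "on_side k N w \<or> on_side k P w"
proof -
  have ne: "dropWhile ((=) k) w \<noteq> []" using assms(2) by (auto simp: dropWhile_eq_Nil_conv)
  then show ?thesis unfolding on_side_def using assms(1) hd_dropWhile_in[OF ne] by blast
qed

lemma on_side_disjoint: "N \<inter> P = {} \<Longrightarrow> on_side k N w \<Longrightarrow> \<not> on_side k P w"
  unfolding on_side_def by blast

lemma darts_sym: "(x, y, J) \<in> darts R m \<Longrightarrow> (y, x, J\<inverse>) \<in> darts R m"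
  unfolding darts_iff_typed_edges by (elim exE, rule_tac x = t in exI) auto

context flip_symmetric_igs
begin

text \<open>The last three conditions keep the two sides apart at all levels: a crossing edge joins
  mirror images and glues only mirror images, and an edge from one side into the letter k never
  attaches to the opposite side inside the cell of k.\<close>

definition reflection_axis :: "'a \<Rightarrow> 'a set \<Rightarrow> 'a set \<Rightarrow> ('a \<Rightarrow> 'a) \<Rightarrow> bool" where
  "reflection_axis k N P \<tau> \<longleftrightarrow> automorphism R \<tau> \<and> (\<forall>x. \<tau> (\<tau> x) = x) \<and> \<tau> k = k \<and>
     igsS R = insert k (N \<union> P) \<and> k \<notin> N \<union> P \<and> N \<inter> P = {} \<and>
     (\<forall>a b J. (a, b, J) \<in> letter_darts R \<longrightarrow>
        (a \<in> N \<and> b \<in> P \<longrightarrow> b = \<tau> a \<and> (\<forall>c d. (c, d) \<in> J \<longrightarrow> d = \<tau> c)) \<and>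
        (a \<in> N \<and> b = k \<longrightarrow> Range J \<inter> P = {}) \<and> (a \<in> P \<and> b = k \<longrightarrow> Range J \<inter> N = {}))"

text \<open>The second and third claims are needed for the induction: a crossing dart could also
  arise by refining a dart that ends on the axis, and they exclude this.\<close>

lemma darts_crossing_axis:
  assumes axis: "reflection_axis k N P \<tau>"
  shows "(x, y, J) \<in> darts R m \<Longrightarrow>
    (on_side k N x \<and> on_side k P y \<longrightarrow> y = map \<tau> x \<and> (\<forall>c d. (c, d) \<in> J \<longrightarrow> d = \<tau> c)) \<and>
    (on_side k N x \<and> set y \<subseteq> {k} \<longrightarrow> Range J \<inter> P = {}) \<and>
    (on_side k P x \<and> set y \<subseteq> {k} \<longrightarrow> Range J \<inter> N = {})"
proof (induction m arbitrary: x y J)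
  case (Suc m)
  from axis[unfolded reflection_axis_def] have \<tau>: "\<tau> k = k" and disj: "N \<inter> P = {}"
    and dart: "\<And>a b J. (a, b, J) \<in> letter_darts R \<Longrightarrow>
        (a \<in> N \<and> b \<in> P \<longrightarrow> b = \<tau> a \<and> (\<forall>c d. (c, d) \<in> J \<longrightarrow> d = \<tau> c)) \<and>
        (a \<in> N \<and> b = k \<longrightarrow> Range J \<inter> P = {}) \<and> (a \<in> P \<and> b = k \<longrightarrow> Range J \<inter> N = {})"
    by (elim conjE; simp)+
  have const: "map \<tau> w = w" if "set w \<subseteq> {k}" for w
    using that \<tau> by (intro map_idI) auto
  from Suc.prems consider
    w a b where "x = w @ [a]" "y = w @ [b]" "(a, b, J) \<in> letter_darts R"
    | w v a b where "x = w @ [a]" "y = v @ [b]" "(w, v, J) \<in> darts R m" "(a, b) \<in> J"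
    by auto
  then show ?case
  proof cases
    case 1
    show ?thesis
    proof (cases "set w \<subseteq> {k}")
      case True
      then show ?thesis using 1 dart[OF 1(3)] const[OF True] by (auto simp: on_side_snoc)
    next
      case False
      then show ?thesis using 1 on_side_disjoint[OF disj, of k w] by (auto simp: on_side_snoc)
    qed
  next
    case 2
    note IH = Suc.IH[OF 2(3)] and IH' = Suc.IH[OF darts_sym[OF 2(3)]]
    have len: "length w = length v" "w \<noteq> v" using darts_words[OF 2(3)] by (auto simp: words_def)
    \<comment> \<open>There is only one axis word of each length.\<close>
    have ne: "\<not> (set w \<subseteq> {k} \<and> set v \<subseteq> {k})"
    proof
      assume "set w \<subseteq> {k} \<and> set v \<subseteq> {k}"
      then have "w = replicate (length w) k" "v = replicate (length v) k"
        by (intro replicate_eqI; blast)+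
      then show False using len by metis
    qed
    have C1: "y = map \<tau> x \<and> (\<forall>c d. (c, d) \<in> J \<longrightarrow> d = \<tau> c)" if s: "on_side k N x" "on_side k P y"
    proof (cases "set w \<subseteq> {k}")
      case True
      \<comment> \<open>This case is contradictory: the reversed dart runs from side P to the axis,
        so its label cannot end in N.\<close>
      then have "a \<in> N" "on_side k P v" using s 2 ne by (auto simp: on_side_snoc split: if_splits)
      then show ?thesis using IH' True 2(4) by auto
    next
      case False
      then have w: "on_side k N w" using s 2 by (simp add: on_side_snoc)
      show ?thesis
      proof (cases "set v \<subseteq> {k}")
        case True
        then have "b \<in> P" using s 2 by (simp add: on_side_snoc)
        then show ?thesis using IH True w 2(4) by auto
      next
        case False
        then have "on_side k P v" using s 2 by (simp add: on_side_snoc)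
        then show ?thesis using IH w 2 by auto
      qed
    qed
    have C2: "Range J \<inter> P = {}" if "on_side k N x" "set y \<subseteq> {k}"
      using that IH ne 2 by (auto simp: on_side_snoc split: if_splits)
    have C3: "Range J \<inter> N = {}" if "on_side k P x" "set y \<subseteq> {k}"
      using that IH ne 2 by (auto simp: on_side_snoc split: if_splits)
    show ?thesis using C1 C2 C3 by blast
  qed
qed auto

text \<open>An edge leaving side N either ends on the axis, whose words \<open>\<tau>\<close> fixes,
  so that the fold acts on it as \<open>\<tau>\<close>, or it ends on side P and collapses. On all
  other edges the fold is \<open>\<tau>\<close> or the identity.\<close>

lemma adj_fold_side:
  assumes axis: "reflection_axis k N P \<tau>" and "adj R m x y"
  shows "fold_side k N \<tau> x = fold_side k N \<tau> y \<or> adj R m (fold_side k N \<tau> x) (fold_side k N \<tau> y)"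
proof -
  have aut: "automorphism R \<tau>" and \<tau>: "\<tau> k = k" and S: "igsS R = insert k (N \<union> P)"
    using axis by (simp_all add: reflection_axis_def)
  have crossing: "fold_side k N \<tau> x = fold_side k N \<tau> y \<or> adj R m (fold_side k N \<tau> x) (fold_side k N \<tau> y)"
    if xy: "adj R m x y" and N: "on_side k N x" "\<not> on_side k N y" for x y
  proof (cases "set y \<subseteq> {k}")
    case True
    then have "map \<tau> y = y" using \<tau> by (intro map_idI) auto
    then show ?thesis using automorphism_adj[OF aut xy] N by (simp add: fold_side_def)
  next
    case False
    then have "on_side k P y"
      using on_side_cases[of y k N P] N adj_words[OF xy] S by (auto simp: words_def)
    moreover obtain J where "(x, y, J) \<in> darts R m" using xy by (auto simp: adj_iff_darts)
    ultimately have "y = map \<tau> x" using darts_crossing_axis[OF axis] N by blast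
    then show ?thesis using N by (simp add: fold_side_def)
  qed
  consider "on_side k N x \<longleftrightarrow> on_side k N y" | "on_side k N x" "\<not> on_side k N y"
    | "on_side k N y" "\<not> on_side k N x" by blast
  then show ?thesis
  proof cases
    case 1
    then show ?thesis using assms(2) automorphism_adj[OF aut] by (simp add: fold_side_def)
  next
    case 2
    then show ?thesis using crossing[OF assms(2)] by blast
  next
    case 3
    then show ?thesis using crossing[OF adj_sym[OF assms(2)]] adj_sym by metis
  qed
qed

lemma transports_fold_side:
  assumes "transports q (words R m) (adj R m) c \<alpha> \<beta>" "0 < q" and axis: "reflection_axis k N P \<tau>"
  shows "transports q (words R m) (adj R m) (4 powr q * c)
    (push (words R m) (fold_side k N \<tau>) \<alpha>) (push (words R m) (fold_side k N \<tau>) \<beta>)"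
proof (rule transports_push_words[OF assms(1,2)])
  have aut: "automorphism R \<tau>" and invol: "\<And>x. \<tau> (\<tau> x) = x"
    using axis by (simp_all add: reflection_axis_def)
  show "fold_side k N \<tau> ` words R m \<subseteq> words R m"
    using automorphism_words[OF aut, of m] by (auto simp: fold_side_def bij_betw_def)
  show "fold_side k N \<tau> x = fold_side k N \<tau> y \<or> adj R m (fold_side k N \<tau> x) (fold_side k N \<tau> y)"
    if "adj R m x y" for x y by (rule adj_fold_side[OF axis that])
  show "card {x' \<in> words R m. fold_side k N \<tau> x' = x} \<le> 2" for x
  proof -
    have "map \<tau> (map \<tau> w) = w" for w using invol by (simp add: map_idI)
    then have "{x' \<in> words R m. fold_side k N \<tau> x' = x} \<subseteq> {x, map \<tau> x}"
      by (auto simp: fold_side_def split: if_splits)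
    then have "card {x' \<in> words R m. fold_side k N \<tau> x' = x} \<le> card {x, map \<tau> x}"
      by (intro card_mono) auto
    also have "\<dots> \<le> 2" by (simp add: card_insert_if)
    finally show ?thesis .
  qed
qed

lemma fold_side_eq_map:
  assumes "reflection_axis k N P \<tau>" "set x \<subseteq> insert k N"
  shows "fold_side k N \<tau> x = map \<tau> x"
proof (cases "on_side k N x")
  case False
  then have "set x \<subseteq> {k}" using on_side_cases[of x k N "{}"] assms(2) by (auto simp: on_side_def)
  moreover have "\<tau> k = k" using assms(1) by (simp add: reflection_axis_def)
  ultimately have "map \<tau> x = x" by (intro map_idI) auto
  then show ?thesis by (simp add: fold_side_def)
qed (simp add: fold_side_def)

lemma fold_side_eq_self:
  assumes "reflection_axis k N P \<tau>" "set x \<subseteq> insert k P"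
  shows "fold_side k N \<tau> x = x"
proof -
  have "\<not> on_side k N x"
    using on_side_letter[of k N x] assms by (auto simp: reflection_axis_def)
  then show ?thesis by (simp add: fold_side_def)
qed

lemma gate_transport_support:
  assumes "gate_transport q t m e \<alpha> \<beta>"
  shows "\<alpha> x \<noteq> 0 \<Longrightarrow> set x \<subseteq> Ipm R t False" "\<beta> x \<noteq> 0 \<Longrightarrow> set x \<subseteq> Ipm R t True"
proof -
  have "\<alpha> x \<noteq> 0 \<Longrightarrow> x \<in> Ipow R m t False" "\<beta> x \<noteq> 0 \<Longrightarrow> x \<in> Ipow R m t True"
    using assms unfolding gate_transport_def by blast+
  then show "\<alpha> x \<noteq> 0 \<Longrightarrow> set x \<subseteq> Ipm R t False" "\<beta> x \<noteq> 0 \<Longrightarrow> set x \<subseteq> Ipm R t True"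
    by (simp_all add: Ipow_def)
qed

lemma shiftable_fold_source:
  assumes "0 < q" and axis: "reflection_axis k N P \<tau>"
    and "Ipm R t False \<subseteq> insert k N" "Ipm R t True \<subseteq> insert k P"
  shows "shiftable q t \<tau>"
  unfolding shiftable_def
\<comment> \<open>Summand 1 pays for \<open>\<alpha>\<close> to \<open>\<beta>\<close>, summand
  \<open>4 powr q\<close> for the folded flow traversed backwards from \<open>\<beta>\<close> to the
  mirror image of \<open>\<alpha>\<close>.\<close>
proof (intro exI[of _ "2 powr q * (1 + 4 powr q)"] allI impI)
  fix m e \<alpha> \<beta> assume gt: "gate_transport q t m e \<alpha> \<beta>"
  let ?W = "words R m"
  have tr: "transports q ?W (adj R m) e \<alpha> \<beta>" using gt by (simp add: gate_transport_def)
  have "push ?W (fold_side k N \<tau>) \<alpha> = push ?W (map \<tau>) \<alpha>"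
  proof (rule push_cong[OF _ finite_words])
    fix x assume "\<alpha> x \<noteq> 0"
    then have "set x \<subseteq> insert k N" using gate_transport_support[OF gt] assms(3) by blast
    then show "fold_side k N \<tau> x = map \<tau> x" by (rule fold_side_eq_map[OF axis])
  qed
  moreover have "push ?W (fold_side k N \<tau>) \<beta> x = \<beta> x" if "x \<in> ?W" for x
  proof (rule push_id_on[OF _ finite_words that])
    fix x assume "\<beta> x \<noteq> 0"
    then have "set x \<subseteq> insert k P" using gate_transport_support[OF gt] assms(4) by blast
    then show "fold_side k N \<tau> x = x" by (rule fold_side_eq_self[OF axis])
  qed
  ultimately have "transports q ?W (adj R m) (4 powr q * e) (push ?W (map \<tau>) \<alpha>) \<beta>"
    using transports_fold_side[OF tr \<open>0 < q\<close> axis]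
    by (subst (asm) transports_cong[where \<alpha>' = "push ?W (map \<tau>) \<alpha>" and \<beta>' = \<beta>]) auto
  from transports_trans[OF tr transports_sym[OF this] \<open>0 < q\<close>]
  show "transports q ?W (adj R m) (2 powr q * (1 + 4 powr q) * e) \<alpha> (push ?W (map \<tau>) \<alpha>)"
    by (simp add: algebra_simps)
qed

lemma shiftable_fold_target:
  assumes "0 < q" and axis: "reflection_axis k N P \<tau>"
    and "Ipm R t False \<subseteq> insert k P" "Ipm R t True \<subseteq> insert k N"
  shows "shiftable q t \<tau>"
  unfolding shiftable_def
\<comment> \<open>The fold moves \<open>\<alpha>\<close> to the mirror image of
  \<open>\<beta>\<close>; the mirrored original flow, reversed, goes on to the mirror image of
  \<open>\<alpha>\<close>.\<close>
proof (intro exI[of _ "2 powr q * (4 powr q + 4 powr q)"] allI impI)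
  fix m e \<alpha> \<beta> assume gt: "gate_transport q t m e \<alpha> \<beta>"
  let ?W = "words R m"
  have aut: "automorphism R \<tau>" using axis by (simp add: reflection_axis_def)
  have tr: "transports q ?W (adj R m) e \<alpha> \<beta>" using gt by (simp add: gate_transport_def)
  have "push ?W (fold_side k N \<tau>) \<beta> = push ?W (map \<tau>) \<beta>"
  proof (rule push_cong[OF _ finite_words])
    fix x assume "\<beta> x \<noteq> 0"
    then have "set x \<subseteq> insert k N" using gate_transport_support[OF gt] assms(4) by blast
    then show "fold_side k N \<tau> x = map \<tau> x" by (rule fold_side_eq_map[OF axis])
  qed
  moreover have "push ?W (fold_side k N \<tau>) \<alpha> x = \<alpha> x" if "x \<in> ?W" for x
  proof (rule push_id_on[OF _ finite_words that])
    fix x assume "\<alpha> x \<noteq> 0"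
    then have "set x \<subseteq> insert k P" using gate_transport_support[OF gt] assms(3) by blast
    then show "fold_side k N \<tau> x = x" by (rule fold_side_eq_self[OF axis])
  qed
  ultimately have "transports q ?W (adj R m) (4 powr q * e) \<alpha> (push ?W (map \<tau>) \<beta>)"
    using transports_fold_side[OF tr \<open>0 < q\<close> axis]
    by (subst (asm) transports_cong[where \<alpha>' = \<alpha> and \<beta>' = "push ?W (map \<tau>) \<beta>"]) auto
  from transports_trans[OF this transports_sym[OF transports_automorphism[OF tr \<open>0 < q\<close> aut]] \<open>0 < q\<close>]
  show "transports q ?W (adj R m) (2 powr q * (4 powr q + 4 powr q) * e) \<alpha> (push ?W (map \<tau>) \<alpha>)"
    by (simp add: algebra_simps)
qed

lemma shiftable_fixing_source:
  assumes "Ipm R t False = {a}" "g a = a"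
  shows "shiftable q t g"
  unfolding shiftable_def
proof (intro exI[of _ 0] allI impI)
  fix m e \<alpha> \<beta> assume gt: "gate_transport q t m e \<alpha> \<beta>"
  let ?W = "words R m"
  have "push ?W (map g) \<alpha> x = \<alpha> x" if "x \<in> ?W" for x
  proof (rule push_id_on[OF _ finite_words that])
    fix x assume "\<alpha> x \<noteq> 0"
    then have "set x \<subseteq> {a}" using gate_transport_support[OF gt] assms(1) by blast
    then show "map g x = x" using assms(2) by (intro map_idI) auto
  qed
  then have "transports q ?W (adj R m) 0 \<alpha> (push ?W (map g) \<alpha>) \<longleftrightarrow> transports q ?W (adj R m) 0 \<alpha> \<alpha>"
    by (intro transports_cong) auto
  then show "transports q ?W (adj R m) (0 * e) \<alpha> (push ?W (map g) \<alpha>)"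
    using transports_refl by simp
qed

text \<open>A distribution on a one-point gate is determined by its total mass, and transports
  preserve total mass; hence moving \<open>\<alpha>\<close> by g yields exactly
  \<open>\<beta>\<close>, and the given flow already does the job.\<close>

lemma shiftable_source_to_target:
  assumes "t \<in> igsT R" "Ipm R t False = {a}" "Ipm R t True = {b}" "automorphism R g" "g a = b"
  shows "shiftable q t g"
  unfolding shiftable_def
proof (intro exI[of _ 1] allI impI)
  fix m e \<alpha> \<beta> assume gt: "gate_transport q t m e \<alpha> \<beta>"
  let ?W = "words R m" and ?a = "replicate m a" and ?b = "replicate m b"
  have W: "?a \<in> ?W" "?b \<in> ?W"
    using gate[OF assms(1), of False] gate[OF assms(1), of True] assms(2,3) by (auto simp: words_def)
  have Ipow: "Ipow R m t False = {?a}" "Ipow R m t True = {?b}"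
    using assms(2,3) by (auto simp: Ipow_def intro!: replicate_eqI)
  have tr: "transports q ?W (adj R m) e \<alpha> \<beta>"
    and \<alpha>: "\<And>x. x \<noteq> ?a \<Longrightarrow> \<alpha> x = 0"
    and \<beta>: "\<And>x. x \<noteq> ?b \<Longrightarrow> \<beta> x = 0"
    using gt unfolding gate_transport_def Ipow by blast+
  have "\<alpha> ?a = (\<Sum>x\<in>?W. \<alpha> x)" "\<beta> ?b = (\<Sum>x\<in>?W. \<beta> x)"
    using sum.remove[OF finite_words W(1), of \<alpha>] sum.remove[OF finite_words W(2), of \<beta>] \<alpha> \<beta>
    by simp_all
  then have ab: "\<alpha> ?a = \<beta> ?b" using transports_sum_eq[OF tr] by simp
  have inj: "inj_on (map g) ?W" using automorphism_words[OF assms(4)] by (simp add: bij_betw_def)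
  have "push ?W (map g) \<alpha> x = \<beta> x" if "x \<in> ?W" for x
  proof (cases "x = ?b")
    case True
    then show ?thesis using push_inj[OF inj W(1), of \<alpha>] ab assms(5) by simp
  next
    case False
    have "push ?W (map g) \<alpha> x = 0"
      unfolding push_def
    proof (intro sum.neutral ballI)
      fix z assume "z \<in> {z \<in> ?W. map g z = x}"
      then have "z \<noteq> ?a" using False assms(5) by auto
      then show "\<alpha> z = 0" by (rule \<alpha>)
    qed
    then show ?thesis using False \<beta> by simp
  qed
  then have "transports q ?W (adj R m) e \<alpha> (push ?W (map g) \<alpha>) \<longleftrightarrow> transports q ?W (adj R m) e \<alpha> \<beta>"
    by (intro transports_cong) auto
  then show "transports q ?W (adj R m) (1 * e) \<alpha> (push ?W (map g) \<alpha>)" using tr by simp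
qed

lemma flip_mem_flip_group: "t \<in> igsT R \<Longrightarrow> flip R t \<in> flip_group R"
  by (drule flip_group.flip[OF _ flip_group.id]) simp

end

section \<open>The gasket and the pentagonal carpet\<close>

lemma involution_permutes:
  assumes "\<And>x. f (f x) = x" "\<And>x. x \<notin> S \<Longrightarrow> f x = x"
  shows "f permutes S"
  unfolding permutes_def using assms by metis

lemma converse_insert_pair: "(insert (a, b) r)\<inverse> = insert (b, a) (r\<inverse>)"
  by auto

lemma letter_darts_image:
  "letter_darts R = (\<lambda>(a, b). (a, b, igsI R (igsTyp R (a, b)))) ` igsE R
     \<union> (\<lambda>(a, b). (b, a, (igsI R (igsTyp R (a, b)))\<inverse>)) ` igsE R"
  by (auto simp: letter_darts_def)

section \<open>Explicit tables of gates, darts and flips\<close>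

lemma gasket_simps:
  "igsS sierpinski_gasket = {0, 1, 2}" "igsT sierpinski_gasket = {0, 1, 2}"
  "Ipm sierpinski_gasket 0 True = {1}" "Ipm sierpinski_gasket 0 False = {0}"
  "Ipm sierpinski_gasket 1 True = {2}" "Ipm sierpinski_gasket 1 False = {1}"
  "Ipm sierpinski_gasket 2 True = {2}" "Ipm sierpinski_gasket 2 False = {0}"
  by (simp_all add: sierpinski_gasket_def Ipm_def)

lemma gasket_letter_darts:
  "letter_darts sierpinski_gasket = {(1, 0, {(0, 1)}), (2, 1, {(1, 2)}), (2, 0, {(0, 2)}),
     (0, 1, {(1, 0)}), (1, 2, {(2, 1)}), (0, 2, {(2, 0)})}"
  by (simp add: letter_darts_image sierpinski_gasket_def converse_insert_pair)

lemma gasket_flip: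
  "flip sierpinski_gasket 0 = Transposition.transpose 0 1"
  "flip sierpinski_gasket 1 = Transposition.transpose 1 2"
  "flip sierpinski_gasket 2 = Transposition.transpose 0 2"
  by (auto simp: fun_eq_iff flip_def sierpinski_gasket_def Transposition.transpose_def)

lemma pentagon_flip_eq:
  "flip pentagonal_carpet t x = (if x < 5 then pent_eta ((t + 3) mod 5) x else x)"
  by (simp add: flip_def pentagonal_carpet_def)

lemma lt_5: "(x::nat) < 5 \<longleftrightarrow> x = 0 \<or> x = 1 \<or> x = 2 \<or> x = 3 \<or> x = 4"
  by auto

text \<open>Each pair of neighbouring letters appears twice, as source gate of one type and as
  target gate of another.\<close>

lemma pentagon_simps:
  "igsS pentagonal_carpet = {0, 1, 2, 3, 4}" "igsT pentagonal_carpet = {0, 1, 2, 3, 4}"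
  "igsE pentagonal_carpet = {(0, 1), (1, 2), (2, 3), (3, 4), (4, 0)}"
  "Ipm pentagonal_carpet 0 True = {1, 2}" "Ipm pentagonal_carpet 0 False = {0, 4}"
  "Ipm pentagonal_carpet 1 True = {2, 3}" "Ipm pentagonal_carpet 1 False = {0, 1}"
  "Ipm pentagonal_carpet 2 True = {3, 4}" "Ipm pentagonal_carpet 2 False = {1, 2}"
  "Ipm pentagonal_carpet 3 True = {0, 4}" "Ipm pentagonal_carpet 3 False = {2, 3}"
  "Ipm pentagonal_carpet 4 True = {0, 1}" "Ipm pentagonal_carpet 4 False = {3, 4}"
  by (auto simp: pentagonal_carpet_def Ipm_def lt_5)

lemma pentagon_letter_darts:
  "letter_darts pentagonal_carpet =
    {(1, 0, {(0, 1), (4, 2)}), (2, 1, {(1, 2), (0, 3)}), (3, 2, {(2, 3), (1, 4)}),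
     (4, 3, {(3, 4), (2, 0)}), (0, 4, {(4, 0), (3, 1)}),
     (0, 1, {(1, 0), (2, 4)}), (1, 2, {(2, 1), (3, 0)}), (2, 3, {(3, 2), (4, 1)}),
     (3, 4, {(4, 3), (0, 2)}), (4, 0, {(0, 4), (1, 3)})}"
  unfolding letter_darts_image pentagon_simps
  by (simp add: pentagonal_carpet_def converse_insert_pair numeral_2_eq_2)

lemma pentagon_flip_involution: "t < 5 \<Longrightarrow> flip pentagonal_carpet t (flip pentagonal_carpet t x) = x"
  unfolding pentagon_flip_eq pent_eta_def by (cases "x < 5") (auto simp: lt_5)

lemma pentagon_flip_letters:
  "flip pentagonal_carpet 0 0 = 1" "flip pentagonal_carpet 0 1 = 0" "flip pentagonal_carpet 0 2 = 4"
  "flip pentagonal_carpet 0 3 = 3" "flip pentagonal_carpet 0 4 = 2"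
  "flip pentagonal_carpet 1 0 = 3" "flip pentagonal_carpet 1 1 = 2" "flip pentagonal_carpet 1 2 = 1"
  "flip pentagonal_carpet 1 3 = 0" "flip pentagonal_carpet 1 4 = 4"
  "flip pentagonal_carpet 2 0 = 0" "flip pentagonal_carpet 2 1 = 4" "flip pentagonal_carpet 2 2 = 3"
  "flip pentagonal_carpet 2 3 = 2" "flip pentagonal_carpet 2 4 = 1"
  "flip pentagonal_carpet 3 0 = 2" "flip pentagonal_carpet 3 1 = 1" "flip pentagonal_carpet 3 2 = 0"
  "flip pentagonal_carpet 3 3 = 4" "flip pentagonal_carpet 3 4 = 3"
  "flip pentagonal_carpet 4 0 = 4" "flip pentagonal_carpet 4 1 = 3" "flip pentagonal_carpet 4 2 = 2"
  "flip pentagonal_carpet 4 3 = 1" "flip pentagonal_carpet 4 4 = 0"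
  by (simp_all add: pentagon_flip_eq pent_eta_def)

lemma gasket_automorphism:
  assumes "t \<in> igsT sierpinski_gasket"
  shows "automorphism sierpinski_gasket (flip sierpinski_gasket t)"
proof -
  have "flip sierpinski_gasket t permutes igsS sierpinski_gasket"
    using assms by (auto simp: gasket_simps gasket_flip simp del: One_nat_def intro!: permutes_swap_id)
  moreover have "(flip sierpinski_gasket t a, flip sierpinski_gasket t b,
      map_prod (flip sierpinski_gasket t) (flip sierpinski_gasket t) ` J) \<in> letter_darts sierpinski_gasket"
    if "(a, b, J) \<in> letter_darts sierpinski_gasket" for a b J
    using that assms unfolding gasket_letter_darts gasket_simps
    by (elim insertE emptyE)
      (simp_all add: gasket_flip Transposition.transpose_def del: One_nat_def)
  ultimately show ?thesis by (simp add: automorphism_def)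
qed

lemma pentagon_automorphism:
  assumes "t \<in> igsT pentagonal_carpet"
  shows "automorphism pentagonal_carpet (flip pentagonal_carpet t)"
proof -
  have "t < 5" using assms by (auto simp: pentagon_simps)
  have "flip pentagonal_carpet t permutes igsS pentagonal_carpet"
  proof (rule involution_permutes)
    show "flip pentagonal_carpet t (flip pentagonal_carpet t x) = x" for x
      using \<open>t < 5\<close> by (rule pentagon_flip_involution)
  qed (simp add: flip_def)
  moreover have "(flip pentagonal_carpet t a, flip pentagonal_carpet t b,
      map_prod (flip pentagonal_carpet t) (flip pentagonal_carpet t) ` J) \<in> letter_darts pentagonal_carpet"
    if "(a, b, J) \<in> letter_darts pentagonal_carpet" for a b J
    using that assms unfolding pentagon_letter_darts pentagon_simps
    by (elim insertE emptyE)
      (simp_all add: pentagon_flip_letters insert_commute doubleton_eq_iff del: One_nat_def)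
  ultimately show ?thesis by (simp add: automorphism_def)
qed

lemma rtranclp_connected_from_root:
  assumes "\<And>x y. r x y \<Longrightarrow> r y x" "\<And>x. x \<in> S \<Longrightarrow> r\<^sup>*\<^sup>* a x" "x \<in> S" "y \<in> S"
  shows "r\<^sup>*\<^sup>* x y"
proof -
  have "r\<^sup>*\<^sup>* x a" using assms(2)[OF assms(3)] assms(1)
    by (induction rule: rtranclp_induct) (auto intro: converse_rtranclp_into_rtranclp)
  then show ?thesis using assms(2)[OF assms(4)] by (rule rtranclp_trans)
qed

lemma letter_darts_sym: "(a, b, J) \<in> letter_darts R \<Longrightarrow> (b, a, J\<inverse>) \<in> letter_darts R"
  by (auto simp: letter_darts_def)

section \<open>Both systems satisfy the general assumptions\<close>

interpretation gasket: flip_symmetric_igs sierpinski_gasket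
proof
  fix a b :: nat assume ab: "a \<in> igsS sierpinski_gasket" "b \<in> igsS sierpinski_gasket"
  let ?r = "\<lambda>a b. \<exists>J. (a, b, J) \<in> letter_darts sierpinski_gasket"
  show "?r\<^sup>*\<^sup>* a b"
  proof (rule rtranclp_connected_from_root[OF _ _ ab, of _ 0])
    show "?r x y \<Longrightarrow> ?r y x" for x y by (auto dest: letter_darts_sym)
    fix x :: nat assume "x \<in> igsS sierpinski_gasket"
    then have "x = 0 \<or> ?r 0 x" unfolding gasket_simps gasket_letter_darts by auto
    then show "?r\<^sup>*\<^sup>* 0 x" by auto
  qed
next
  fix t s assume "t \<in> igsT sierpinski_gasket"
  then show "flip sierpinski_gasket t ` Ipm sierpinski_gasket t s = Ipm sierpinski_gasket t (\<not> s)"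
    unfolding gasket_simps
    by (cases s; elim insertE emptyE)
      (simp_all add: gasket_simps gasket_flip Transposition.transpose_def del: One_nat_def)
next
  fix t s assume "t \<in> igsT sierpinski_gasket"
  then show "Ipm sierpinski_gasket t s \<subseteq> igsS sierpinski_gasket \<and> Ipm sierpinski_gasket t s \<noteq> {}"
    unfolding gasket_simps
    by (cases s; elim insertE emptyE) (simp_all add: gasket_simps del: One_nat_def)
next
  fix t assume "t \<in> igsT sierpinski_gasket"
  then show "Ipm sierpinski_gasket t False \<inter> Ipm sierpinski_gasket t True = {}"
    unfolding gasket_simps
    by (elim insertE emptyE) (simp_all add: gasket_simps del: One_nat_def)
next
  fix a b b' J
  assume "(a, b, J) \<in> letter_darts sierpinski_gasket" "(a, b', J) \<in> letter_darts sierpinski_gasket"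
  then show "b = b'"
    unfolding gasket_letter_darts
    by (elim insertE emptyE) (simp_all del: One_nat_def)
next
  fix a b J
  assume J: "(a, b, J) \<in> letter_darts sierpinski_gasket"
  show "single_valued J"
    using J unfolding gasket_letter_darts single_valued_def
    by (elim insertE emptyE) (simp_all del: One_nat_def)
  show "a \<notin> Domain J"
    using J unfolding gasket_letter_darts
    by (elim insertE emptyE) (simp_all del: One_nat_def)
  show "a \<in> igsS sierpinski_gasket \<and> b \<in> igsS sierpinski_gasket \<and> a \<noteq> b \<and> J \<noteq> {} \<and>
      J \<subseteq> igsS sierpinski_gasket \<times> igsS sierpinski_gasket"
    using J unfolding gasket_letter_darts gasket_simps
    by (elim insertE emptyE) (simp_all del: One_nat_def)
qed (simp_all add: gasket_automorphism gasket_simps gasket_letter_darts)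

interpretation pentagon: flip_symmetric_igs pentagonal_carpet
proof
  fix a b :: nat assume ab: "a \<in> igsS pentagonal_carpet" "b \<in> igsS pentagonal_carpet"
  let ?r = "\<lambda>a b. \<exists>J. (a, b, J) \<in> letter_darts pentagonal_carpet"
  show "?r\<^sup>*\<^sup>* a b"
  proof (rule rtranclp_connected_from_root[OF _ _ ab, of _ 0])
    show "?r x y \<Longrightarrow> ?r y x" for x y by (auto dest: letter_darts_sym)
    have "?r 0 1" "?r 1 2" "?r 0 4" "?r 4 3" unfolding pentagon_letter_darts by auto
    then have r: "?r\<^sup>*\<^sup>* 0 1" "?r\<^sup>*\<^sup>* 0 2" "?r\<^sup>*\<^sup>* 0 4" "?r\<^sup>*\<^sup>* 0 3"
      by (blast intro: rtranclp.intros)+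
    fix x :: nat assume "x \<in> igsS pentagonal_carpet"
    then show "?r\<^sup>*\<^sup>* 0 x" unfolding pentagon_simps using r by auto
  qed
next
  fix t s assume "t \<in> igsT pentagonal_carpet"
  then show "flip pentagonal_carpet t ` Ipm pentagonal_carpet t s = Ipm pentagonal_carpet t (\<not> s)"
    unfolding pentagon_simps
    by (cases s; elim insertE emptyE)
      (simp_all add: pentagon_simps pentagon_flip_letters insert_commute del: One_nat_def)
next
  fix t s assume "t \<in> igsT pentagonal_carpet"
  then show "Ipm pentagonal_carpet t s \<subseteq> igsS pentagonal_carpet \<and> Ipm pentagonal_carpet t s \<noteq> {}"
    unfolding pentagon_simps
    by (cases s; elim insertE emptyE) (simp_all add: pentagon_simps del: One_nat_def)
next
  fix t assume "t \<in> igsT pentagonal_carpet"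
  then show "Ipm pentagonal_carpet t False \<inter> Ipm pentagonal_carpet t True = {}"
    unfolding pentagon_simps
    by (elim insertE emptyE) (simp_all add: pentagon_simps del: One_nat_def)
next
  fix a b b' J
  assume "(a, b, J) \<in> letter_darts pentagonal_carpet" "(a, b', J) \<in> letter_darts pentagonal_carpet"
  then show "b = b'"
    unfolding pentagon_letter_darts
    by (elim insertE emptyE) (simp_all add: doubleton_eq_iff del: One_nat_def)
next
  fix a b J
  assume J: "(a, b, J) \<in> letter_darts pentagonal_carpet"
  show "single_valued J"
    using J unfolding pentagon_letter_darts single_valued_def
    by (elim insertE emptyE) (simp_all del: One_nat_def)
  show "a \<notin> Domain J"
    using J unfolding pentagon_letter_darts
    by (elim insertE emptyE) (simp_all del: One_nat_def)
  show "a \<in> igsS pentagonal_carpet \<and> b \<in> igsS pentagonal_carpet \<and> a \<noteq> b \<and> J \<noteq> {} \<and>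
      J \<subseteq> igsS pentagonal_carpet \<times> igsS pentagonal_carpet"
    using J unfolding pentagon_letter_darts pentagon_simps
    by (elim insertE emptyE) (simp_all del: One_nat_def)
qed (simp_all add: pentagon_automorphism pentagon_simps pentagon_letter_darts)

text \<open>For type 0 the gates are the corners 0 and 1: flip 0 carries source to target, flip 1
  fixes the source, and flip 2 is the conjugate of flip 0 by flip 1.\<close>

lemma gasket_shiftable:
  assumes "0 < q" "t \<in> igsT sierpinski_gasket"
  shows "gasket.shiftable q 0 (flip sierpinski_gasket t)"
proof -
  let ?R = sierpinski_gasket
  have aut: "automorphism ?R (flip ?R 0)" "automorphism ?R (flip ?R 1)"
    by (auto intro!: gasket_automorphism simp: gasket_simps)
  have s0: "gasket.shiftable q 0 (flip ?R 0)"
    using aut(1) by (intro gasket.shiftable_source_to_target[of 0 0 1])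
      (auto simp: gasket_simps gasket_flip simp del: One_nat_def)
  have s1: "gasket.shiftable q 0 (flip ?R 1)"
    by (intro gasket.shiftable_fixing_source[of 0 0])
      (auto simp: gasket_simps gasket_flip Transposition.transpose_def simp del: One_nat_def)
  have eq: "flip ?R 2 = flip ?R 1 \<circ> (flip ?R 0 \<circ> flip ?R 1)"
    by (auto simp: fun_eq_iff gasket_flip Transposition.transpose_def simp del: One_nat_def)
  have "gasket.shiftable q 0 (flip ?R 2)"
    unfolding eq by (intro gasket.shiftable_comp gasket.automorphism_comp aut s0 s1 assms(1))
  then show ?thesis using assms(2) s0 s1 unfolding gasket_simps by blast
qed

theorem gasket_flow_bases:
  assumes "0 < q"
  shows "\<exists>C > 0. \<forall>m \<ge> 1. \<exists>FB. is_flow_basis sierpinski_gasket m FB \<and>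
    (\<forall>t \<in> igsT sierpinski_gasket. fb_energy q sierpinski_gasket m FB
      \<le> C * eff_energy q (words sierpinski_gasket m) (edges sierpinski_gasket m)
          (Ipow sierpinski_gasket m t False) (Ipow sierpinski_gasket m t True))"
proof (rule gasket.flow_bases_bounded[OF assms, of 0])
  let ?R = sierpinski_gasket
  have mem: "flip ?R 0 \<in> flip_group ?R" "flip ?R 1 \<in> flip_group ?R" "flip ?R 2 \<in> flip_group ?R"
    by (auto intro!: gasket.flip_mem_flip_group simp: gasket_simps)
  fix t assume t: "t \<in> igsT ?R"
  show "gasket.shiftable q 0 (flip ?R t)" using assms t by (rule gasket_shiftable)
  show "\<exists>g\<in>flip_group ?R. g ` Ipm ?R 0 False = Ipm ?R t s" for s
  proof -
    have "Ipm ?R t s \<in> {id ` {0}, flip ?R 0 ` {0}, flip ?R 2 ` {0}}"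
      using t by (cases s) (auto simp: gasket_simps gasket_flip simp del: One_nat_def)
    then show ?thesis unfolding gasket_simps using mem flip_group.id by blast
  qed
  have aut: "automorphism ?R id" "automorphism ?R (flip ?R 1 \<circ> flip ?R 0)" "automorphism ?R (flip ?R 1)"
    by (intro gasket.automorphism_id gasket.automorphism_comp gasket_automorphism; simp add: gasket_simps)+
  show "\<exists>g. automorphism ?R g \<and> g ` Ipm ?R t False = Ipm ?R 0 False \<and> g ` Ipm ?R t True = Ipm ?R 0 True"
    using t[unfolded gasket_simps]
  proof (elim insertE emptyE)
    assume "t = 0"
    then show ?thesis using aut(1) by (intro exI[of _ id]) simp
  next
    \<comment> \<open>The product below sends 1 to 0 and 2 to 1, thus the gates of type 1 to those
      of type 0 in the right order.\<close>
    assume "t = 1"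
    then show ?thesis using aut(2)
      by (intro exI[of _ "flip ?R 1 \<circ> flip ?R 0"])
        (simp add: gasket_simps gasket_flip Transposition.transpose_def del: One_nat_def)
  next
    assume "t = 2"
    then show ?thesis using aut(3)
      by (intro exI[of _ "flip ?R 1"])
        (simp add: gasket_simps gasket_flip Transposition.transpose_def del: One_nat_def)
  qed
qed (simp add: gasket_simps)

text \<open>Both axes separate the gates {0, 1} and {2, 3} of type 1: the first passes through a
  letter of the source gate, the second through a letter of the target gate.\<close>

lemma pentagon_axes:
  "pentagon.reflection_axis 1 {0, 4} {2, 3} (flip pentagonal_carpet 3)"
  "pentagon.reflection_axis 2 {3, 4} {0, 1} (flip pentagonal_carpet 4)"
proof -
  let ?R = pentagonal_carpet
  have dart1: "(a \<in> {0, 4} \<and> b \<in> {2, 3} \<longrightarrow> b = flip ?R 3 a \<and> (\<forall>c d. (c, d) \<in> J \<longrightarrow> d = flip ?R 3 c)) \<and>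
      (a \<in> {0, 4} \<and> b = 1 \<longrightarrow> Range J \<inter> {2, 3} = {}) \<and> (a \<in> {2, 3} \<and> b = 1 \<longrightarrow> Range J \<inter> {0, 4} = {})"
    and dart2: "(a \<in> {3, 4} \<and> b \<in> {0, 1} \<longrightarrow> b = flip ?R 4 a \<and> (\<forall>c d. (c, d) \<in> J \<longrightarrow> d = flip ?R 4 c)) \<and>
      (a \<in> {3, 4} \<and> b = 2 \<longrightarrow> Range J \<inter> {0, 1} = {}) \<and> (a \<in> {0, 1} \<and> b = 2 \<longrightarrow> Range J \<inter> {3, 4} = {})"
    if "(a, b, J) \<in> letter_darts ?R" for a b J
    using that unfolding pentagon_letter_darts
    by (elim insertE emptyE; auto simp: pentagon_flip_letters simp del: One_nat_def)+
  show "pentagon.reflection_axis 1 {0, 4} {2, 3} (flip ?R 3)"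
    unfolding pentagon.reflection_axis_def using dart1 pentagon_flip_involution[of 3]
    by (auto simp: pentagon_automorphism pentagon_simps pentagon_flip_letters simp del: One_nat_def)
  show "pentagon.reflection_axis 2 {3, 4} {0, 1} (flip ?R 4)"
    unfolding pentagon.reflection_axis_def using dart2 pentagon_flip_involution[of 4]
    by (auto simp: pentagon_automorphism pentagon_simps pentagon_flip_letters simp del: One_nat_def)
qed

text \<open>Conjugating the reflection that fixes k by s gives the reflection that fixes
  \<open>s k\<close>. The fixed letters 3, 0, 4 of flips 0, 2, 1 arise as flip 4 of 1, flip 3 of 2
  and flip 0 of 2.\<close>

lemma pentagon_flip_relations:
  "flip pentagonal_carpet 0 = flip pentagonal_carpet 4 \<circ> (flip pentagonal_carpet 3 \<circ> flip pentagonal_carpet 4)"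
  "flip pentagonal_carpet 2 = flip pentagonal_carpet 3 \<circ> (flip pentagonal_carpet 4 \<circ> flip pentagonal_carpet 3)"
  "flip pentagonal_carpet 1 = flip pentagonal_carpet 0 \<circ> (flip pentagonal_carpet 4 \<circ> flip pentagonal_carpet 0)"
proof -
  have eqI: "f = g" if "\<And>x. x \<ge> 5 \<Longrightarrow> f x = g x" "f 0 = g 0" "f 1 = g 1" "f 2 = g 2" "f 3 = g 3" "f 4 = g 4"
    for f g :: "nat \<Rightarrow> nat"
  proof
    show "f x = g x" for x using that lt_5[of x] by (cases "x < 5") auto
  qed
  show "flip pentagonal_carpet 0 = flip pentagonal_carpet 4 \<circ> (flip pentagonal_carpet 3 \<circ> flip pentagonal_carpet 4)"
    by (rule eqI) (simp_all add: pentagon_flip_letters del: One_nat_def, simp add: flip_def pentagon_simps)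
  show "flip pentagonal_carpet 2 = flip pentagonal_carpet 3 \<circ> (flip pentagonal_carpet 4 \<circ> flip pentagonal_carpet 3)"
    by (rule eqI) (simp_all add: pentagon_flip_letters del: One_nat_def, simp add: flip_def pentagon_simps)
  show "flip pentagonal_carpet 1 = flip pentagonal_carpet 0 \<circ> (flip pentagonal_carpet 4 \<circ> flip pentagonal_carpet 0)"
    by (rule eqI) (simp_all add: pentagon_flip_letters del: One_nat_def, simp add: flip_def pentagon_simps)
qed

lemma pentagon_shiftable:
  assumes "0 < q" "t \<in> igsT pentagonal_carpet"
  shows "pentagon.shiftable q 1 (flip pentagonal_carpet t)"
proof -
  let ?R = pentagonal_carpet
  have aut: "automorphism ?R (flip ?R 3)" "automorphism ?R (flip ?R 4)" "automorphism ?R (flip ?R 0)"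
    by (auto intro!: pentagon_automorphism simp: pentagon_simps)
  have s3: "pentagon.shiftable q 1 (flip ?R 3)"
    by (rule pentagon.shiftable_fold_source[OF assms(1) pentagon_axes(1)]) (auto simp: pentagon_simps simp del: One_nat_def)
  have s4: "pentagon.shiftable q 1 (flip ?R 4)"
    by (rule pentagon.shiftable_fold_target[OF assms(1) pentagon_axes(2)]) (auto simp: pentagon_simps simp del: One_nat_def)
  have s0: "pentagon.shiftable q 1 (flip ?R 0)"
    unfolding pentagon_flip_relations(1)
    by (intro pentagon.shiftable_comp pentagon.automorphism_comp aut s3 s4 assms(1))
  have s2: "pentagon.shiftable q 1 (flip ?R 2)"
    unfolding pentagon_flip_relations(2)
    by (intro pentagon.shiftable_comp pentagon.automorphism_comp aut s3 s4 assms(1))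
  have s1: "pentagon.shiftable q 1 (flip ?R 1)"
    unfolding pentagon_flip_relations(3)
    by (intro pentagon.shiftable_comp pentagon.automorphism_comp aut s0 s4 assms(1))
  show ?thesis using assms(2) s0 s1 s2 s3 s4 unfolding pentagon_simps by blast
qed

theorem pentagon_flow_bases:
  assumes "0 < q"
  shows "\<exists>C > 0. \<forall>m \<ge> 1. \<exists>FB. is_flow_basis pentagonal_carpet m FB \<and>
    (\<forall>t \<in> igsT pentagonal_carpet. fb_energy q pentagonal_carpet m FB
      \<le> C * eff_energy q (words pentagonal_carpet m) (edges pentagonal_carpet m)
          (Ipow pentagonal_carpet m t False) (Ipow pentagonal_carpet m t True))"
proof (rule pentagon.flow_bases_bounded[OF assms, of 1])
  let ?R = pentagonal_carpet
  have mem: "flip ?R t \<in> flip_group ?R" if "t \<in> {0, 1, 2, 3, 4}" for t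
    using that by (intro pentagon.flip_mem_flip_group) (simp add: pentagon_simps)
  fix t assume t: "t \<in> igsT ?R"
  show "pentagon.shiftable q 1 (flip ?R t)" using assms t by (rule pentagon_shiftable)
  show "\<exists>g\<in>flip_group ?R. g ` Ipm ?R 1 False = Ipm ?R t s" for s
  proof -
    \<comment> \<open>The five reflections carry one side of the pentagon to its five sides, so a
      single flip reaches each gate.\<close>
    have "\<exists>t'\<in>{0, 1, 2, 3, 4}. Ipm ?R t s = flip ?R t' ` {0, 1}"
      using t unfolding pentagon_simps
      by (cases s; elim insertE emptyE)
        (simp_all add: pentagon_simps pentagon_flip_letters doubleton_eq_iff del: One_nat_def)
    then show ?thesis unfolding pentagon_simps using mem by metis
  qed
  have aut: "automorphism ?R (flip ?R t' \<circ> flip ?R 0)" if "t' \<in> {0, 1, 2, 3, 4}" for t'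
    using that by (intro pentagon.automorphism_comp pentagon_automorphism) (simp_all add: pentagon_simps)
  \<comment> \<open>Source and target have to be matched in order, which takes a rotation; the
    products of a flip with flip 0 are the five rotations.\<close>
  have "\<exists>t'\<in>{0, 1, 2, 3, 4}. (flip ?R t' \<circ> flip ?R 0) ` Ipm ?R t False = Ipm ?R 1 False \<and>
      (flip ?R t' \<circ> flip ?R 0) ` Ipm ?R t True = Ipm ?R 1 True"
    using t unfolding pentagon_simps
    by (elim insertE emptyE)
      (simp_all add: pentagon_simps pentagon_flip_letters doubleton_eq_iff del: One_nat_def)
  then show "\<exists>g. automorphism ?R g \<and> g ` Ipm ?R t False = Ipm ?R 1 False \<and> g ` Ipm ?R t True = Ipm ?R 1 True"
    using aut by blast
qed (simp add: pentagon_simps)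

theorem theorem6p13:
  fixes R :: "(nat, nat) igs" and p q :: real
  assumes "R \<in> {sierpinski_gasket, pentagonal_carpet}"
    and "p > 1" and "q = p / (p - 1)"
  shows "\<exists>C > 0. \<forall>m \<ge> 1. \<exists>FB. is_flow_basis R m FB \<and>
           (\<forall>t \<in> igsT R. fb_energy q R m FB
              \<le> C * eff_energy q (words R m) (edges R m) (Ipow R m t False) (Ipow R m t True))"
proof -
  have "0 < q" using assms(2,3) by simp
  then show ?thesis using assms(1) gasket_flow_bases pentagon_flow_bases by blast
qed

end
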